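(* Let $\mathcal A=\{\mathbf a_1,\dots,\mathbf a_n\}\subset\mathbb Z^d$ be a graded vector configuration with $\dim(\mathcal A)=d$ that is $\Delta$-normal with respect to the regular triangulation $\Delta$ of $\mathcal A$. Then there exists a term order $\succ$ on $R=\mathbb K[x_1,\dots,x_n]$ such that $\Delta=\Delta_\succ$ and the reduced Gröbner basis of $I_{\mathcal A}$ with respect to $\succ$ consists of binomials of degree at most $d=\dim(\mathcal A)$.
   Context: Let $\mathbb K$ be a field, $\mathbb N=\{0,1,2,\dots\}$, and $\mathcal A=\{\mathbf a_1,\dots,\mathbf a_n\}\subset\mathbb Z^d$ a finite vector configuration. The toric ideal of $\mathcal A$ is $I_{\mathcal A}=\langle \mathbf x^{\mathbf u}-\mathbf x^{\mathbf v} : \mathbf u,\mathbf v\in\mathbb N^n,\ \sum_i u_i\mathbf a_i=\sum_i v_i\mathbf a_i\rangle\subseteq R=\mathbb K[x_1,\dots,x_n]$. $cone(\mathcal A)$, $\mathbb Z\mathcal A$, $\mathbb N\mathcal A$ are the sets of $\mathbb R_{\ge0}$-, $\mathbb Z$-, $\mathbb N$-linear combinations of $\mathcal A$. $\dim(\mathcal A)$ is the Krull dimension of $R/I_{\mathcal A}$, which equals the rank of $\mathbb Z\mathcal A$; it is assumed that $\dim(\mathcal A)=d$. $\mathcal A$ is graded if it spans an affine hyperplane in $\mathbb R^d$. Degree is the usual degree with $\deg(x_i)=1$. For $\tau\subseteq[n]=\{1,\dots,n\}$ put $\mathcal A_\tau=\{\mathbf a_i: i\in\tau\}$. A pure $(d-1)$-dimensional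 simplicial complex $\Delta$ on $[n]$ (not every element of $[n]$ need be used), with set of facets ($d$-element faces) $\max\Delta$, is a triangulation of $\mathcal A$ if $cone(\mathcal A)=\bigcup_{\sigma\in\max\Delta}cone(\mathcal A_\sigma)$ and $cone(\mathcal A_{\sigma})\cap cone(\mathcal A_{\sigma'})=cone(\mathcal A_{\sigma\cap\sigma'})$ for all $\sigma,\sigma'\in\max\Delta$. The Stanley-Reisner ideal of $\Delta$ is $\langle\prod_{i\in\tau}x_i:\tau\notin\Delta\rangle$. For a term order $\succ$, the radical of $in_\succ(I_{\mathcal A})$ is the Stanley-Reisner ideal of a triangulation of $\mathcal A$ (a theorem of Sturmfels), denoted $\Delta_\succ$; triangulations arising in this way from monomial initial ideals of $I_{\mathcal A}$ are called regular. $\mathcal A$ is $\Delta$-normal if $\Delta$ is a regular triangulation of $\mathcal A$ such that for each $\sigma\in\max\Delta$, $\mathcal A\cap cone(\mathcal A_\sigma)$ is a Hilbert basis of $cone(\mathcal A_\sigma)\cap\mathbb Z\mathcal A$, i.e. $\mathbb N(\mathcal A\cap cone(\mathcal A_\sigma))=cone(\mathcal A_\sigma)\cap\mathbb Z\mathcal A$. *)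

theory Defs
  imports "HOL-Analysis.Analysis" "HOL-Library.Poly_Mapping" "HOL-Library.Extended_Nat"
begin

section \<open>Ideals of a commutative ring\<close>

definition is_ideal :: "'a::comm_ring_1 set \<Rightarrow> bool" where
  "is_ideal I \<longleftrightarrow> 0 \<in> I \<and> (\<forall>x\<in>I. \<forall>y\<in>I. x + y \<in> I) \<and> (\<forall>r. \<forall>x\<in>I. r * x \<in> I)"

abbreviation ideal_gen :: "'a::comm_ring_1 set \<Rightarrow> 'a set" where
  "ideal_gen S \<equiv> is_ideal hull S"

definition is_prime_ideal :: "'a::comm_ring_1 set \<Rightarrow> bool" where
  "is_prime_ideal P \<longleftrightarrow> is_ideal P \<and> 1 \<notin> P \<and> (\<forall>x y. x * y \<in> P \<longrightarrow> x \<in> P \<or> y \<in> P)"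

definition radical :: "'a::comm_ring_1 set \<Rightarrow> 'a set" where
  "radical I = {f. \<exists>k::nat. f ^ k \<in> I}"

text \<open>The Krull dimension of the quotient of the ring by \<open>I\<close>: prime ideals of the quotient
  are represented by the prime ideals of the ring that contain \<open>I\<close>, and a chain with \<open>m\<close> proper
  inclusions has length \<open>m\<close>. (For the unit ideal, where there is no chain, the value is 0.)\<close>

definition prime_chain_over :: "'a::comm_ring_1 set \<Rightarrow> nat \<Rightarrow> (nat \<Rightarrow> 'a set) \<Rightarrow> bool" where
  "prime_chain_over I m P \<longleftrightarrow>
     (\<forall>i\<le>m. is_prime_ideal (P i) \<and> I \<subseteq> P i) \<and> (\<forall>i<m. P i \<subset> P (Suc i))"

definition krull_dim_quotient :: "'a::comm_ring_1 set \<Rightarrow> enat" where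
  "krull_dim_quotient I = (SUP m \<in> {m. \<exists>P. prime_chain_over I m P}. enat m)"


section \<open>Polynomials and Groebner bases\<close>

text \<open>The finite type \<open>'n\<close> indexes the variables; \<open>'n \<Rightarrow>\<^sub>0 nat\<close> is the type of exponent vectors
  and \<open>('n, 'k) mpoly\<close> is the polynomial ring over \<open>'k\<close>, with the convolution product of
  \<^theory>\<open>HOL-Library.Poly_Mapping\<close>.\<close>

type_synonym 'n expo = "'n \<Rightarrow>\<^sub>0 nat"
type_synonym ('n, 'k) mpoly = "('n \<Rightarrow>\<^sub>0 nat) \<Rightarrow>\<^sub>0 'k"

definition mon :: "'n expo \<Rightarrow> ('n, 'k::field) mpoly" where
  "mon u = Poly_Mapping.single u 1"

definition var :: "'n \<Rightarrow> ('n, 'k::field) mpoly" where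
  "var i = mon (Poly_Mapping.single i 1)"

definition total_degree :: "('n::finite, 'k::field) mpoly \<Rightarrow> nat" where
  "total_degree p = Max (insert 0 ((\<lambda>u. \<Sum>i\<in>UNIV. Poly_Mapping.lookup u i) ` Poly_Mapping.keys p))"

definition is_binomial :: "('n, 'k::field) mpoly \<Rightarrow> bool" where
  "is_binomial p \<longleftrightarrow> (\<exists>u v. u \<noteq> v \<and> p = mon u - mon v)"

text \<open>A term order is given by its strict part: \<open>lt u v\<close> means that the monomial with
  exponent \<open>v\<close> is the larger one.\<close>

definition term_order :: "('n expo \<Rightarrow> 'n expo \<Rightarrow> bool) \<Rightarrow> bool" where
  "term_order lt \<longleftrightarrow> irreflp lt \<and> transp lt \<and> totalp lt \<and>
     (\<forall>u. u \<noteq> 0 \<longrightarrow> lt 0 u) \<and> (\<forall>u v w. lt u v \<longrightarrow> lt (u + w) (v + w))"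

definition lead_expo :: "('n expo \<Rightarrow> 'n expo \<Rightarrow> bool) \<Rightarrow> ('n, 'k::field) mpoly \<Rightarrow> 'n expo" where
  "lead_expo lt p =
     (THE u. u \<in> Poly_Mapping.keys p \<and> (\<forall>v\<in>Poly_Mapping.keys p. v \<noteq> u \<longrightarrow> lt v u))"

definition initial_ideal ::
  "('n expo \<Rightarrow> 'n expo \<Rightarrow> bool) \<Rightarrow> ('n, 'k::field) mpoly set \<Rightarrow> ('n, 'k) mpoly set" where
  "initial_ideal lt I = ideal_gen {mon (lead_expo lt f) | f. f \<in> I \<and> f \<noteq> 0}"

definition is_reduced_groebner_basis ::
  "('n expo \<Rightarrow> 'n expo \<Rightarrow> bool) \<Rightarrow> ('n, 'k::field) mpoly set \<Rightarrow> ('n, 'k) mpoly set \<Rightarrow> bool" where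
  "is_reduced_groebner_basis lt I G \<longleftrightarrow>
     finite G \<and> G \<subseteq> I \<and> 0 \<notin> G \<and>
     initial_ideal lt I = ideal_gen {mon (lead_expo lt g) | g. g \<in> G} \<and>
     (\<forall>g\<in>G. Poly_Mapping.lookup g (lead_expo lt g) = 1) \<and>
     (\<forall>g\<in>G. \<forall>h\<in>G. g \<noteq> h \<longrightarrow> (\<forall>u\<in>Poly_Mapping.keys h. \<nexists>w. u = lead_expo lt g + w))"


section \<open>Vector configurations and toric ideals\<close>

text \<open>A configuration is a family \<open>a :: 'n \<Rightarrow> int ^ 'd\<close>, and a subconfiguration is given by a set of
  indices.\<close>

definition real_vec :: "int ^ 'd \<Rightarrow> real ^ 'd" where
  "real_vec v = (\<chi> j. real_of_int (v $ j))"

definition toric_ideal :: "('n::finite \<Rightarrow> int ^ 'd) \<Rightarrow> ('n, 'k::field) mpoly set" where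
  "toric_ideal a = ideal_gen {mon u - mon v | u v.
     (\<Sum>i\<in>UNIV. int (Poly_Mapping.lookup u i) *s a i) =
     (\<Sum>i\<in>UNIV. int (Poly_Mapping.lookup v i) *s a i)}"

definition cone_on :: "('n::finite \<Rightarrow> int ^ 'd) \<Rightarrow> 'n set \<Rightarrow> (real ^ 'd) set" where
  "cone_on a \<tau> = {\<Sum>i\<in>\<tau>. c i *\<^sub>R real_vec (a i) | c. \<forall>i\<in>\<tau>. 0 \<le> c i}"

definition int_span_on :: "('n::finite \<Rightarrow> int ^ 'd) \<Rightarrow> 'n set \<Rightarrow> (int ^ 'd) set" where
  "int_span_on a \<tau> = {\<Sum>i\<in>\<tau>. c i *s a i | c :: 'n \<Rightarrow> int. True}"

definition nat_span_on :: "('n::finite \<Rightarrow> int ^ 'd) \<Rightarrow> 'n set \<Rightarrow> (int ^ 'd) set" where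
  "nat_span_on a \<tau> = {\<Sum>i\<in>\<tau>. int (c i) *s a i | c :: 'n \<Rightarrow> nat. True}"

definition graded_config :: "('n::finite \<Rightarrow> int ^ 'd::finite) \<Rightarrow> bool" where
  "graded_config a \<longleftrightarrow>
     (\<exists>c b. c \<noteq> 0 \<and> affine hull (range (\<lambda>i. real_vec (a i))) = {x. c \<bullet> x = b})"


section \<open>Triangulations\<close>

definition simplicial_complex :: "'n set set \<Rightarrow> bool" where
  "simplicial_complex \<Delta> \<longleftrightarrow> \<Delta> \<noteq> {} \<and> (\<forall>\<sigma>\<in>\<Delta>. \<forall>\<tau>. \<tau> \<subseteq> \<sigma> \<longrightarrow> \<tau> \<in> \<Delta>)"

definition facets :: "'n set set \<Rightarrow> 'n set set" where
  "facets \<Delta> = {\<sigma> \<in> \<Delta>. \<forall>\<tau>\<in>\<Delta>. \<sigma> \<subseteq> \<tau> \<longrightarrow> \<tau> = \<sigma>}"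

definition triangulation :: "('n::finite \<Rightarrow> int ^ 'd::finite) \<Rightarrow> 'n set set \<Rightarrow> bool" where
  "triangulation a \<Delta> \<longleftrightarrow>
     simplicial_complex \<Delta> \<and> (\<forall>\<sigma>\<in>facets \<Delta>. card \<sigma> = CARD('d)) \<and>
     cone_on a UNIV = (\<Union>\<sigma>\<in>facets \<Delta>. cone_on a \<sigma>) \<and>
     (\<forall>\<sigma>\<in>facets \<Delta>. \<forall>\<sigma>'\<in>facets \<Delta>. cone_on a \<sigma> \<inter> cone_on a \<sigma>' = cone_on a (\<sigma> \<inter> \<sigma>'))"

definition stanley_reisner_ideal :: "'n::finite set set \<Rightarrow> ('n, 'k::field) mpoly set" where
  "stanley_reisner_ideal \<Delta> = ideal_gen {\<Prod>i\<in>\<tau>. var i | \<tau>. \<tau> \<notin> \<Delta>}"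

text \<open>\<open>is_initial_complex lt I \<Delta>\<close> says that \<open>\<Delta>\<close> is the initial complex of \<open>I\<close> for the term order \<open>lt\<close>;
  this determines \<open>\<Delta>\<close>, as a simplicial complex is determined by its Stanley-Reisner ideal.\<close>

definition is_initial_complex ::
  "('n expo \<Rightarrow> 'n expo \<Rightarrow> bool) \<Rightarrow> ('n::finite, 'k::field) mpoly set \<Rightarrow> 'n set set \<Rightarrow> bool" where
  "is_initial_complex lt I \<Delta> \<longleftrightarrow>
     simplicial_complex \<Delta> \<and> radical (initial_ideal lt I) = stanley_reisner_ideal \<Delta>"

text \<open>Regularity refers to initial ideals over the coefficient field, which is not visible in the
  configuration; it is passed as a type argument.\<close>

definition regular_triangulation ::
  "'k::field itself \<Rightarrow> ('n::finite \<Rightarrow> int ^ 'd::finite) \<Rightarrow> 'n set set \<Rightarrow> bool" where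
  "regular_triangulation K a \<Delta> \<longleftrightarrow> triangulation a \<Delta> \<and>
     (\<exists>lt. term_order lt \<and> is_initial_complex lt (toric_ideal a :: ('n, 'k) mpoly set) \<Delta>)"

definition delta_normal ::
  "'k::field itself \<Rightarrow> ('n::finite \<Rightarrow> int ^ 'd::finite) \<Rightarrow> 'n set set \<Rightarrow> bool" where
  "delta_normal K a \<Delta> \<longleftrightarrow> regular_triangulation K a \<Delta> \<and>
     (\<forall>\<sigma>\<in>facets \<Delta>. nat_span_on a {i. real_vec (a i) \<in> cone_on a \<sigma>} =
        {z \<in> int_span_on a UNIV. real_vec z \<in> cone_on a \<sigma>})"

end

theory Submission
  imports Defs
begin

text \<open>Every vector of the configuration is, up to a common factor \<open>M\<close>, a nonnegative integer
  combination of vertices of the facet whose cone contains it. Extending this additively gives a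
  projection \<open>proj\<close> from monomials to monomials in the vertices, which amounts to lowering the heights
  of all non-vertices onto the lifted triangulation. The new term order compares projections by a
  term order \<open>lt0\<close> that induces \<open>\<Delta>\<close>, and breaks ties in favour of the larger degree in the vertices.
  By normality, a monomial whose projection is not supported on a face is not standard; since a
  minimal nonface has at most \<open>d\<close> elements, the minimal such monomials have degree at most \<open>d\<close>. Over a
  facet \<open>\<sigma>\<close> normality and the tie-break force the standard monomials to be products of powers of the
  vertices of \<open>\<sigma>\<close> with a standard monomial whose vector lies in the half-open fundamental
  parallelepiped of \<open>\<sigma>\<close>. The latter has degree less than \<open>d\<close>, so a minimal nonstandard monomial of
  larger degree would share a vertex with the standard monomial of its fibre, and cancelling it
  contradicts minimality.\<close>

abbreviation lookup :: "('a \<Rightarrow>\<^sub>0 'b::zero) \<Rightarrow> 'a \<Rightarrow> 'b" where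
  "lookup \<equiv> Poly_Mapping.lookup"

abbreviation keys :: "('a \<Rightarrow>\<^sub>0 'b::zero) \<Rightarrow> 'a set" where
  "keys \<equiv> Poly_Mapping.keys"

section \<open>Monomial ideals\<close>

lemma is_ideal_ideal_gen: "is_ideal (ideal_gen S)"
  by (rule hull_in) (auto simp: is_ideal_def)

lemma is_ideal_sum:
  assumes "is_ideal I" "finite A" "\<And>x. x \<in> A \<Longrightarrow> f x \<in> I"
  shows "sum f A \<in> I"
  using assms(2,3) by (induction A rule: finite_induct) (use assms(1) in \<open>auto simp: is_ideal_def\<close>)

lemma is_ideal_mult_left: "is_ideal I \<Longrightarrow> x \<in> I \<Longrightarrow> r * x \<in> I"
  by (auto simp: is_ideal_def)

lemma is_ideal_radical:
  fixes I :: "'a::comm_ring_1 set"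
  assumes I: "is_ideal I"
  shows "is_ideal (radical I)"
  unfolding is_ideal_def
proof (intro conjI ballI allI)
  have "(0::'a) ^ 1 \<in> I" using I by (simp add: is_ideal_def)
  then show "0 \<in> radical I" unfolding radical_def by blast
next
  fix x y assume "x \<in> radical I" "y \<in> radical I"
  then obtain m n where m: "x ^ m \<in> I" and n: "y ^ n \<in> I" unfolding radical_def by blast
  have "(x + y) ^ (m + n) = (\<Sum>k\<le>m + n. of_nat ((m + n) choose k) * x ^ k * y ^ (m + n - k))"
    by (rule binomial_ring)
  also have "\<dots> \<in> I"
  proof (rule is_ideal_sum[OF I])
    fix k assume "k \<in> {..m + n}"
    show "of_nat ((m + n) choose k) * x ^ k * y ^ (m + n - k) \<in> I"
    proof (cases "k \<ge> m")
      case True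
      then have "x ^ k = x ^ (k - m) * x ^ m" by (simp flip: power_add)
      then have "of_nat ((m + n) choose k) * x ^ k * y ^ (m + n - k)
          = (of_nat ((m + n) choose k) * x ^ (k - m) * y ^ (m + n - k)) * x ^ m"
        by (simp add: mult_ac)
      then show ?thesis using is_ideal_mult_left[OF I m] by simp
    next
      case False
      then have "y ^ (m + n - k) = y ^ (m - k) * y ^ n" by (simp flip: power_add)
      then have "of_nat ((m + n) choose k) * x ^ k * y ^ (m + n - k)
          = (of_nat ((m + n) choose k) * x ^ k * y ^ (m - k)) * y ^ n"
        by (simp add: mult_ac)
      then show ?thesis using is_ideal_mult_left[OF I n] by simp
    qed
  qed simp
  finally show "x + y \<in> radical I" unfolding radical_def by blast
next
  fix r x assume "x \<in> radical I"
  then obtain m where m: "x ^ m \<in> I" unfolding radical_def by blast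
  have "(r * x) ^ m \<in> I"
    using is_ideal_mult_left[OF I m] by (simp add: power_mult_distrib)
  then show "r * x \<in> radical I" unfolding radical_def by blast
qed

lemma sum_single_lookup: "(\<Sum>u\<in>keys f. Poly_Mapping.single u (lookup f u)) = f"
proof (rule poly_mapping_eqI)
  fix k
  have "lookup (\<Sum>u\<in>keys f. Poly_Mapping.single u (lookup f u)) k
      = (\<Sum>u\<in>keys f. if u = k then lookup f u else 0)"
    by (simp add: lookup_sum lookup_single when_def)
  also have "\<dots> = lookup f k" by (simp add: in_keys_iff)
  finally show "lookup (\<Sum>u\<in>keys f. Poly_Mapping.single u (lookup f u)) k = lookup f k" .
qed

lemma single_eq_mult_mon: "Poly_Mapping.single (w + u) c = Poly_Mapping.single w c * mon u"
  by (simp add: mon_def mult_single)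

text \<open>\<open>N\<close> consists of the exponents divisible by an element of \<open>B\<close>.
  Multiplication keeps supports inside \<open>N\<close>, and each term of a polynomial supported on
  \<open>N\<close> is a multiple of a generator. Questions about monomial ideals thereby become
  questions about exponents.\<close>

lemma ideal_gen_mon:
  fixes N B :: "'n expo set"
  assumes N: "\<And>u. u \<in> N \<longleftrightarrow> (\<exists>b\<in>B. \<exists>w. u = b + w)"
  shows "ideal_gen (mon ` B) = {f :: ('n, 'k::field) mpoly. keys f \<subseteq> N}"
proof
  have N_add: "w + u \<in> N" if "u \<in> N" for u w
    using that unfolding N by (metis add.commute add.left_commute)
  show "ideal_gen (mon ` B) \<subseteq> {f :: ('n, 'k) mpoly. keys f \<subseteq> N}"
  proof (rule hull_minimal)
    show "mon ` B \<subseteq> {f :: ('n, 'k) mpoly. keys f \<subseteq> N}"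
      unfolding mon_def using N by auto (metis add.right_neutral)
    have "keys (r * x) \<subseteq> N" if "keys x \<subseteq> N" for r x :: "('n, 'k) mpoly"
      using keys_mult[of r x] N_add that by blast
    moreover have "keys (x + y) \<subseteq> N" if "keys x \<subseteq> N" "keys y \<subseteq> N" for x y :: "('n, 'k) mpoly"
      using Poly_Mapping.keys_add[of x y] that by blast
    ultimately show "is_ideal {f :: ('n, 'k) mpoly. keys f \<subseteq> N}"
      by (auto simp: is_ideal_def)
  qed
next
  show "{f :: ('n, 'k) mpoly. keys f \<subseteq> N} \<subseteq> ideal_gen (mon ` B)"
  proof
    fix f :: "('n, 'k) mpoly" assume f: "f \<in> {f. keys f \<subseteq> N}"
    have "(\<Sum>u\<in>keys f. Poly_Mapping.single u (lookup f u)) \<in> ideal_gen (mon ` B)"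
    proof (rule is_ideal_sum[OF is_ideal_ideal_gen])
      fix u assume "u \<in> keys f"
      then have "u \<in> N" using f by blast
      then obtain b w where b: "b \<in> B" and u: "u = w + b" unfolding N by (auto simp: add.commute)
      have "mon b \<in> ideal_gen (mon ` B)" using b by (intro hull_inc) auto
      then show "Poly_Mapping.single u (lookup f u) \<in> ideal_gen (mon ` B)"
        unfolding u single_eq_mult_mon by (rule is_ideal_mult_left[OF is_ideal_ideal_gen])
    qed simp
    then show "f \<in> ideal_gen (mon ` B)" by (simp add: sum_single_lookup)
  qed
qed

lemma mult_eq_sum_single:
  "f * g = (\<Sum>a\<in>keys f. \<Sum>b\<in>keys g. Poly_Mapping.single (a + b) (lookup f a * lookup g b))"
proof -
  have "f * g = (\<Sum>a\<in>keys f. Poly_Mapping.single a (lookup f a)) *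
      (\<Sum>b\<in>keys g. Poly_Mapping.single b (lookup g b))"
    by (simp add: sum_single_lookup)
  then show ?thesis by (simp add: sum_product mult_single)
qed

section \<open>Exponent vectors and squarefree monomials\<close>

definition expo_of :: "('n::finite \<Rightarrow> nat) \<Rightarrow> 'n expo" where
  "expo_of f = Abs_poly_mapping f"

lemma lookup_expo_of [simp]: "lookup (expo_of f) i = f i"
  by (simp add: expo_of_def)

lemma keys_expo_of: "keys (expo_of f) = {i. f i \<noteq> 0}"
  by (auto simp: in_keys_iff)

lemma keys_expo_add: "keys (u + v) = keys u \<union> keys (v :: 'n expo)"
  by (auto simp: in_keys_iff lookup_add)

definition indic_expo :: "'n::finite set \<Rightarrow> 'n expo" where
  "indic_expo S = expo_of (\<lambda>i. if i \<in> S then 1 else 0)"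

lemma keys_indic_expo [simp]: "keys (indic_expo S) = S"
  by (auto simp: indic_expo_def keys_expo_of)

lemma expo_diff_add:
  fixes u v :: "'n expo"
  assumes "\<And>i. lookup v i \<le> lookup u i"
  shows "u = v + (u - v)"
  using assms by (intro poly_mapping_eqI) (simp add: lookup_add lookup_minus)

lemma mon_power: "mon u ^ k = mon (expo_of (\<lambda>i. k * lookup u i))"
proof (induction k)
  case 0
  have "expo_of (\<lambda>i. 0 * lookup u i) = 0" by (intro poly_mapping_eqI) simp
  then show ?case by (simp add: mon_def)
next
  case (Suc k)
  have "expo_of (\<lambda>i. Suc k * lookup u i) = u + expo_of (\<lambda>i. k * lookup u i)"
    by (intro poly_mapping_eqI) (simp add: lookup_add)
  then show ?case unfolding power_Suc Suc by (simp add: mon_def mult_single)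
qed

lemma prod_var: "(\<Prod>i\<in>\<tau>. var i) = mon (indic_expo \<tau>)" for \<tau> :: "'n::finite set"
proof -
  have "finite \<tau>" by simp
  then show ?thesis
  proof (induction \<tau> rule: finite_induct)
    case empty
    have "indic_expo {} = (0 :: 'n expo)" by (intro poly_mapping_eqI) (simp add: indic_expo_def)
    then show ?case by (simp add: mon_def)
  next
    case (insert x F)
    have "Poly_Mapping.single x 1 + indic_expo F = indic_expo (insert x F)"
      using insert by (intro poly_mapping_eqI)
        (auto simp: indic_expo_def lookup_add lookup_single when_def)
    then show ?case using insert by (simp add: var_def mon_def mult_single)
  qed
qed

text \<open>A monomial is divisible by the squarefree monomial of its support, and supersets of
  nonfaces are nonfaces, so divisibility by a generator depends on the support alone.\<close>

lemma stanley_reisner_ideal_eq: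
  fixes \<Delta> :: "'n::finite set set"
  assumes "simplicial_complex \<Delta>"
  shows "stanley_reisner_ideal \<Delta> = {f :: ('n, 'k::field) mpoly. \<forall>u\<in>keys f. keys u \<notin> \<Delta>}"
proof -
  have *: "u \<in> {u. keys u \<notin> \<Delta>} \<longleftrightarrow> (\<exists>b\<in>indic_expo ` (- \<Delta>). \<exists>w. u = b + w)" for u :: "'n expo"
  proof
    assume u: "u \<in> {u. keys u \<notin> \<Delta>}"
    have "u = indic_expo (keys u) + (u - indic_expo (keys u))"
      by (rule expo_diff_add) (auto simp: indic_expo_def in_keys_iff)
    then show "\<exists>b\<in>indic_expo ` (- \<Delta>). \<exists>w. u = b + w" using u by blast
  next
    assume "\<exists>b\<in>indic_expo ` (- \<Delta>). \<exists>w. u = b + w"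
    then obtain \<tau> w where "\<tau> \<notin> \<Delta>" "u = indic_expo \<tau> + w" by blast
    then show "u \<in> {u. keys u \<notin> \<Delta>}"
      using assms unfolding simplicial_complex_def by (auto simp: keys_expo_add)
  qed
  have "{\<Prod>i\<in>\<tau>. var i | \<tau>. \<tau> \<notin> \<Delta>} = (mon ` indic_expo ` (- \<Delta>) :: ('n, 'k) mpoly set)"
    by (auto simp: prod_var image_iff) 
  then show ?thesis
    unfolding stanley_reisner_ideal_def using ideal_gen_mon[OF *, where 'k = 'k] by auto
qed

section \<open>Term orders\<close>

lemma keys_mon_diff:
  assumes "u \<noteq> v"
  shows "keys (mon u - mon v :: ('n, 'k::field) mpoly) = {u, v}"
  using assms by (auto simp: in_keys_iff lookup_minus mon_def lookup_single when_def split: if_splits)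

context
  fixes lt :: "'n expo \<Rightarrow> 'n expo \<Rightarrow> bool"
  assumes lt: "term_order lt"
begin

lemma term_order_irrefl: "\<not> lt u u"
  using lt by (auto simp: term_order_def irreflp_def)

lemma term_order_trans: "lt u v \<Longrightarrow> lt v w \<Longrightarrow> lt u w"
  using lt by (auto simp: term_order_def dest: transpD)

lemma term_order_total: "u \<noteq> v \<Longrightarrow> lt u v \<or> lt v u"
  using lt by (auto simp: term_order_def totalp_on_def)

lemma term_order_add: "lt u v \<Longrightarrow> lt (u + w) (v + w)"
  using lt by (auto simp: term_order_def)

lemma term_order_zero: "u \<noteq> 0 \<Longrightarrow> lt 0 u"
  using lt by (auto simp: term_order_def)

lemma term_order_add_cancel: "lt (u + w) (v + w) \<longleftrightarrow> lt u v"
  by (metis term_order_add term_order_irrefl term_order_total term_order_trans)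

lemma finite_has_lt_max:
  assumes "finite A" "A \<noteq> {}"
  shows "\<exists>u\<in>A. \<forall>v\<in>A. v \<noteq> u \<longrightarrow> lt v u"
  using assms
proof (induction A rule: finite_ne_induct)
  case (insert x F)
  then obtain u where u: "u \<in> F" "\<forall>v\<in>F. v \<noteq> u \<longrightarrow> lt v u" by blast
  show ?case
  proof (cases "lt u x")
    case True
    then have "\<forall>v\<in>insert x F. v \<noteq> x \<longrightarrow> lt v x" using u term_order_trans by (metis insert_iff)
    then show ?thesis by blast
  next
    case False
    then have "\<forall>v\<in>insert x F. v \<noteq> u \<longrightarrow> lt v u" using u term_order_total by blast
    then show ?thesis using u by blast
  qed
qed simp

lemma finite_has_lt_min:
  assumes "finite A" "A \<noteq> {}"
  shows "\<exists>u\<in>A. \<forall>v\<in>A. v \<noteq> u \<longrightarrow> lt u v"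
  using assms
proof (induction A rule: finite_ne_induct)
  case (insert x F)
  then obtain u where u: "u \<in> F" "\<forall>v\<in>F. v \<noteq> u \<longrightarrow> lt u v" by blast
  show ?case
  proof (cases "lt x u")
    case True
    then have "\<forall>v\<in>insert x F. v \<noteq> x \<longrightarrow> lt x v" using u term_order_trans by (metis insert_iff)
    then show ?thesis by blast
  next
    case False
    then have "\<forall>v\<in>insert x F. v \<noteq> u \<longrightarrow> lt u v" using u term_order_total by blast
    then show ?thesis using u by blast
  qed
qed simp

lemma lead_expo_eqI:
  assumes "u \<in> keys p" "\<forall>v\<in>keys p. v \<noteq> u \<longrightarrow> lt v u"
  shows "lead_expo lt p = u"
  unfolding lead_expo_def
proof (rule the_equality)
  fix v assume "v \<in> keys p \<and> (\<forall>w\<in>keys p. w \<noteq> v \<longrightarrow> lt w v)"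
  then show "v = u" using assms term_order_trans term_order_irrefl by metis
qed (use assms in blast)

lemma lead_expo:
  assumes "p \<noteq> 0"
  shows "lead_expo lt p \<in> keys p" "\<And>v. v \<in> keys p \<Longrightarrow> v \<noteq> lead_expo lt p \<Longrightarrow> lt v (lead_expo lt p)"
proof -
  have "keys p \<noteq> {}" using assms by simp
  then obtain u where u: "u \<in> keys p" "\<forall>v\<in>keys p. v \<noteq> u \<longrightarrow> lt v u"
    using finite_has_lt_max[of "keys p"] by auto
  then have "lead_expo lt p = u" by (rule lead_expo_eqI)
  with u show "lead_expo lt p \<in> keys p" "\<And>v. v \<in> keys p \<Longrightarrow> v \<noteq> lead_expo lt p \<Longrightarrow> lt v (lead_expo lt p)"
    by auto
qed

lemma lead_expo_mon_diff:
  assumes "lt v u"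
  shows "lead_expo lt (mon u - mon v :: ('n, 'k::field) mpoly) = u"
proof (rule lead_expo_eqI)
  have "u \<noteq> v" using assms term_order_irrefl by blast
  note k = keys_mon_diff[OF this, where 'k = 'k]
  show "u \<in> keys (mon u - mon v :: ('n, 'k) mpoly)" unfolding k by simp
  show "\<forall>w\<in>keys (mon u - mon v :: ('n, 'k) mpoly). w \<noteq> u \<longrightarrow> lt w u"
    unfolding k using assms by simp
qed

text \<open>Setting the variables outside \<open>F\<close> to zero is a ring homomorphism;
  \<open>u\<close> is the leading exponent of the image of \<open>f\<close>.\<close>

definition face_top :: "'n set \<Rightarrow> ('n, 'k::field) mpoly \<Rightarrow> 'n expo \<Rightarrow> bool" where
  "face_top F f u \<longleftrightarrow> u \<in> keys f \<and> keys u \<subseteq> F \<and>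
     (\<forall>v\<in>keys f. keys v \<subseteq> F \<longrightarrow> v \<noteq> u \<longrightarrow> lt v u)"

text \<open>A product of monomials is supported on \<open>F\<close> exactly when both factors are,
  so this is multiplicativity of leading terms in the polynomial ring on \<open>F\<close>. The top
  coefficient arises from one pair only, and a field has no zero divisors.\<close>

lemma face_top_mult:
  fixes f g :: "('n, 'k::field) mpoly"
  assumes f: "face_top F f u" and g: "face_top F g v"
  shows "face_top F (f * g) (u + v)"
proof -
  have strict: "lt (a + b) (u + v)"
    if "a \<in> keys f" "b \<in> keys g" "keys (a + b) \<subseteq> F" "a \<noteq> u \<or> b \<noteq> v" for a b
  proof -
    have "keys a \<subseteq> F" "keys b \<subseteq> F" using that(3) by (auto simp: keys_expo_add)
    then have a: "a \<noteq> u \<Longrightarrow> lt a u" and b: "b \<noteq> v \<Longrightarrow> lt b v"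
      using f g that(1,2) unfolding face_top_def by blast+
    have "lt (a + b) (u + b)" if "a \<noteq> u" using term_order_add[OF a[OF that]] .
    moreover have "lt (u + b) (u + v)" if "b \<noteq> v"
      using term_order_add[OF b[OF that], of u] by (simp add: add.commute)
    ultimately show ?thesis using that(4) term_order_trans by metis
  qed
  have uv: "u \<in> keys f" "v \<in> keys g" "keys (u + v) \<subseteq> F"
    using f g by (auto simp: face_top_def keys_expo_add)
  have "lookup (f * g) (u + v)
      = (\<Sum>a\<in>keys f. \<Sum>b\<in>keys g. (lookup f a * lookup g b when a + b = u + v))"
    by (subst mult_eq_sum_single) (simp add: lookup_sum lookup_single)
  also have "\<dots> = (\<Sum>a\<in>keys f. \<Sum>b\<in>keys g.
      if a = u then if b = v then lookup f a * lookup g b else 0 else 0)"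
  proof (intro sum.cong refl)
    fix a b assume ab: "a \<in> keys f" "b \<in> keys g"
    have "a = u \<and> b = v" if "a + b = u + v"
      using strict[OF ab] that uv term_order_irrefl by metis
    then show "(lookup f a * lookup g b when a + b = u + v)
        = (if a = u then if b = v then lookup f a * lookup g b else 0 else 0)"
      by (auto simp: when_def)
  qed
  also have "\<dots> = (\<Sum>a\<in>keys f. if a = u then lookup f a * lookup g v else 0)"
    using uv by (intro sum.cong refl) auto
  also have "\<dots> = lookup f u * lookup g v"
    using uv by simp
  finally have "u + v \<in> keys (f * g)" using uv by (simp add: in_keys_iff)
  moreover have "lt w (u + v)" if w: "w \<in> keys (f * g)" "keys w \<subseteq> F" "w \<noteq> u + v" for w
  proof -
    obtain a b where "a \<in> keys f" "b \<in> keys g" "w = a + b" using keys_mult[of f g] w(1) by blast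
    then show ?thesis using strict w by blast
  qed
  ultimately show ?thesis using uv by (auto simp: face_top_def)
qed

lemma face_top_power:
  fixes f :: "('n, 'k::field) mpoly"
  assumes "face_top F f u"
  shows "\<exists>v. face_top F (f ^ k) v"
proof (induction k)
  case 0
  have "face_top F (1 :: ('n, 'k) mpoly) 0" by (simp add: face_top_def)
  then show ?case by auto
next
  case (Suc k)
  then show ?case using face_top_mult[OF assms] by auto
qed

text \<open>Stanley-Reisner ideals are radical. If \<open>f\<close> had a term supported on a face,
  its restriction to that face would have a leading term, and so would the restriction of every
  power of \<open>f\<close>.\<close>

lemma stanley_reisner_ideal_radical:
  fixes f :: "('n, 'k::field) mpoly"
  assumes fk: "\<forall>u\<in>keys (f ^ k). keys u \<notin> \<Delta>" and u: "u \<in> keys f" and \<Delta>: "simplicial_complex \<Delta>"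
  shows "keys u \<notin> \<Delta>"
proof
  assume u\<Delta>: "keys u \<in> \<Delta>"
  let ?A = "{v \<in> keys f. keys v \<subseteq> keys u}"
  have "\<exists>m\<in>?A. \<forall>v\<in>?A. v \<noteq> m \<longrightarrow> lt v m" using u by (intro finite_has_lt_max) auto
  then obtain m where "face_top (keys u) f m" unfolding face_top_def by blast
  then obtain v where "face_top (keys u) (f ^ k) v" using face_top_power by blast
  then show False using fk u\<Delta> \<Delta> unfolding face_top_def simplicial_complex_def by blast
qed

end

section \<open>Toric ideals\<close>

definition expo_vec :: "('n::finite \<Rightarrow> int ^ 'd) \<Rightarrow> 'n expo \<Rightarrow> int ^ 'd" where
  "expo_vec a u = (\<Sum>i\<in>UNIV. int (lookup u i) *s a i)"

lemma expo_vec_add: "expo_vec a (u + v) = expo_vec a u + expo_vec a v"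
  by (simp add: expo_vec_def lookup_add vector_sadd_rdistrib sum.distrib)

lemma toric_ideal_def': "toric_ideal a = ideal_gen {mon u - mon v | u v. expo_vec a u = expo_vec a v}"
  by (simp add: toric_ideal_def expo_vec_def)

text \<open>The coefficient of \<open>t^z\<close> in the image of \<open>f\<close> under the
  homomorphism from polynomials to Laurent polynomials that sends each variable \<open>x_i\<close>
  to \<open>t^(a i)\<close>.\<close>

definition fibre_sum :: "('n::finite \<Rightarrow> int ^ 'd) \<Rightarrow> int ^ 'd \<Rightarrow> ('n, 'k::field) mpoly \<Rightarrow> 'k" where
  "fibre_sum a z f = (\<Sum>u\<in>keys f. if expo_vec a u = z then lookup f u else 0)"

lemma fibre_sum_superset:
  assumes "finite A" "keys f \<subseteq> A"
  shows "fibre_sum a z f = (\<Sum>u\<in>A. if expo_vec a u = z then lookup f u else 0)"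
  unfolding fibre_sum_def using assms by (intro sum.mono_neutral_left) (auto simp: in_keys_iff)

lemma fibre_sum_add: "fibre_sum a z (f + g) = fibre_sum a z f + fibre_sum a z g"
proof -
  let ?A = "keys f \<union> keys g"
  have "fibre_sum a z (f + g) = (\<Sum>u\<in>?A. if expo_vec a u = z then lookup (f + g) u else 0)"
    using Poly_Mapping.keys_add[of f g] by (intro fibre_sum_superset) auto
  also have "\<dots> = (\<Sum>u\<in>?A. if expo_vec a u = z then lookup f u else 0) +
      (\<Sum>u\<in>?A. if expo_vec a u = z then lookup g u else 0)"
    unfolding sum.distrib[symmetric] by (intro sum.cong) (auto simp: lookup_add)
  also have "\<dots> = fibre_sum a z f + fibre_sum a z g"
    by (subst (1 2) fibre_sum_superset[of ?A]) auto
  finally show ?thesis .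
qed

lemma fibre_sum_sum: "fibre_sum a z (\<Sum>x\<in>A. h x) = (\<Sum>x\<in>A. fibre_sum a z (h x))"
proof (induction A rule: infinite_finite_induct)
qed (simp_all add: fibre_sum_add, simp_all add: fibre_sum_def)

lemma fibre_sum_single: "fibre_sum a z (Poly_Mapping.single u c) = (if expo_vec a u = z then c else 0)"
  by (cases "c = 0") (auto simp: fibre_sum_def)

text \<open>This shows that the polynomials all of whose fibre sums vanish form an ideal, which
  therefore contains the toric ideal.\<close>

lemma fibre_sum_mult:
  "fibre_sum a z (f * g) = (\<Sum>w\<in>keys f. lookup f w * fibre_sum a (z - expo_vec a w) g)"
  by (subst mult_eq_sum_single)
    (auto simp: fibre_sum_sum fibre_sum_single expo_vec_add fibre_sum_def[of _ _ g]
      sum_distrib_left algebra_simps intro!: sum.cong)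

lemma fibre_sum_toric_ideal:
  fixes f :: "('n::finite, 'k::field) mpoly"
  assumes "f \<in> toric_ideal a"
  shows "fibre_sum a z f = 0"
proof -
  have "toric_ideal a \<subseteq> {f :: ('n, 'k) mpoly. \<forall>z. fibre_sum a z f = 0}"
    unfolding toric_ideal_def'
  proof (rule hull_minimal)
    have "fibre_sum a z (mon u - mon v :: ('n, 'k) mpoly) = 0" if "expo_vec a u = expo_vec a v" for u v z
    proof -
      have "mon u - mon v = Poly_Mapping.single u 1 + Poly_Mapping.single v (- 1 :: 'k)"
        by (simp add: mon_def single_uminus)
      then show ?thesis using that by (simp add: fibre_sum_add fibre_sum_single)
    qed
    then show "{mon u - mon v | u v. expo_vec a u = expo_vec a v}
        \<subseteq> {f :: ('n, 'k) mpoly. \<forall>z. fibre_sum a z f = 0}" by auto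
    show "is_ideal {f :: ('n, 'k) mpoly. \<forall>z. fibre_sum a z f = 0}"
      by (auto simp: is_ideal_def fibre_sum_add fibre_sum_mult) (simp add: fibre_sum_def)
  qed
  then show ?thesis using assms by blast
qed

section \<open>Standard monomials and the initial ideal of a toric ideal\<close>

definition nonstandard :: "('n::finite \<Rightarrow> int ^ 'd) \<Rightarrow> ('n expo \<Rightarrow> 'n expo \<Rightarrow> bool) \<Rightarrow> 'n expo set" where
  "nonstandard a lt = {u. \<exists>v. expo_vec a v = expo_vec a u \<and> lt v u}"

text \<open>If the leading exponent of \<open>f\<close> were the only exponent of \<open>f\<close>
  in its fibre, the fibre sum would be the leading coefficient, which is not zero. Conversely, a
  smaller exponent in the fibre of \<open>u\<close> yields a binomial with leading exponent
  \<open>u\<close>.\<close>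

lemma lead_expo_toric_ideal:
  fixes a :: "'n::finite \<Rightarrow> int ^ 'd"
  assumes lt: "term_order lt"
  shows "{lead_expo lt f | f. f \<in> (toric_ideal a :: ('n, 'k::field) mpoly set) \<and> f \<noteq> 0} = nonstandard a lt"
proof (intro equalityI subsetI)
  fix u assume "u \<in> {lead_expo lt f | f. f \<in> (toric_ideal a :: ('n, 'k) mpoly set) \<and> f \<noteq> 0}"
  then obtain f :: "('n, 'k) mpoly" where f: "f \<in> toric_ideal a" "f \<noteq> 0" "u = lead_expo lt f" by blast
  note u = lead_expo[OF lt f(2), folded f(3)]
  have "\<exists>v\<in>keys f. v \<noteq> u \<and> expo_vec a v = expo_vec a u"
  proof (rule ccontr)
    assume "\<not> ?thesis"
    then have "fibre_sum a (expo_vec a u) f = (\<Sum>v\<in>keys f. if v = u then lookup f v else 0)"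
      unfolding fibre_sum_def by (intro sum.cong) auto
    also have "\<dots> = lookup f u" using u(1) by simp
    finally show False using fibre_sum_toric_ideal[OF f(1)] u(1) by (auto simp: in_keys_iff)
  qed
  then show "u \<in> nonstandard a lt" using u(2) unfolding nonstandard_def by blast
next
  fix u assume "u \<in> nonstandard a lt"
  then obtain v where v: "expo_vec a v = expo_vec a u" "lt v u" unfolding nonstandard_def by blast
  let ?f = "mon u - mon v :: ('n, 'k) mpoly"
  have "u \<noteq> v" using v term_order_irrefl[OF lt] by blast
  then have "?f \<noteq> 0" using keys_mon_diff[of u v, where 'k = 'k] by auto
  moreover have "?f \<in> toric_ideal a"
    unfolding toric_ideal_def' using v(1)[symmetric] by (intro hull_inc) blast
  moreover have "lead_expo lt ?f = u" using lead_expo_mon_diff[OF lt v(2)] .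
  ultimately show "u \<in> {lead_expo lt f | f. f \<in> (toric_ideal a :: ('n, 'k) mpoly set) \<and> f \<noteq> 0}"
    by (intro CollectI exI[of _ ?f]) simp
qed

lemma nonstandard_add:
  assumes "term_order lt" "u \<in> nonstandard a lt"
  shows "u + w \<in> nonstandard a lt"
  using assms unfolding nonstandard_def by (auto simp: expo_vec_add dest: term_order_add)
    (metis expo_vec_add term_order_add)

lemma initial_ideal_toric:
  fixes a :: "'n::finite \<Rightarrow> int ^ 'd"
  assumes lt: "term_order lt"
  shows "initial_ideal lt (toric_ideal a :: ('n, 'k::field) mpoly set)
    = {f. keys f \<subseteq> nonstandard a lt}"
proof -
  let ?I = "toric_ideal a :: ('n, 'k) mpoly set"
  have "{mon (lead_expo lt f) | f. f \<in> ?I \<and> f \<noteq> 0}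
      = (mon ` nonstandard a lt :: ('n, 'k) mpoly set)"
    unfolding lead_expo_toric_ideal[OF lt, of a, where 'k = 'k, symmetric] by blast
  moreover have "ideal_gen (mon ` nonstandard a lt) = {f :: ('n, 'k) mpoly. keys f \<subseteq> nonstandard a lt}"
  proof (rule ideal_gen_mon)
    fix u
    show "u \<in> nonstandard a lt \<longleftrightarrow> (\<exists>b\<in>nonstandard a lt. \<exists>w. u = b + w)"
    proof
      assume "u \<in> nonstandard a lt"
      then show "\<exists>b\<in>nonstandard a lt. \<exists>w. u = b + w" by (intro bexI[of _ u] exI[of _ 0]) simp_all
    next
      assume "\<exists>b\<in>nonstandard a lt. \<exists>w. u = b + w"
      then show "u \<in> nonstandard a lt" using nonstandard_add[OF lt] by fast
    qed
  qed
  ultimately show ?thesis unfolding initial_ideal_def by simp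
qed

section \<open>Degrees, normal forms and the reduced Groebner basis\<close>

definition expo_deg :: "'n::finite expo \<Rightarrow> nat" where
  "expo_deg u = (\<Sum>i\<in>UNIV. lookup u i)"

lemma expo_deg_add: "expo_deg (u + v) = expo_deg u + expo_deg v"
  by (simp add: expo_deg_def lookup_add sum.distrib)

lemma finite_expo_deg_le: "finite {u :: 'n::finite expo. expo_deg u \<le> D}"
proof (rule finite_imageD)
  have "lookup u i \<le> D" if "expo_deg u \<le> D" for u :: "'n expo" and i
    using member_le_sum[of i UNIV "lookup u"] that by (simp add: expo_deg_def)
  then have "lookup ` {u :: 'n expo. expo_deg u \<le> D} \<subseteq> PiE UNIV (\<lambda>_. {..D})" by auto
  then show "finite (lookup ` {u :: 'n expo. expo_deg u \<le> D})"
    by (rule finite_subset) (intro finite_PiE, auto)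
  show "inj_on lookup {u :: 'n expo. expo_deg u \<le> D}"
    by (auto intro!: inj_onI poly_mapping_eqI)
qed

definition minimal_nonstandard ::
  "('n::finite \<Rightarrow> int ^ 'd) \<Rightarrow> ('n expo \<Rightarrow> 'n expo \<Rightarrow> bool) \<Rightarrow> 'n expo set" where
  "minimal_nonstandard a lt =
    {u \<in> nonstandard a lt. \<forall>w\<in>nonstandard a lt. \<forall>s. u = w + s \<longrightarrow> w = u}"

lemma nonstandard_above_minimal:
  "u \<in> nonstandard a lt \<Longrightarrow> \<exists>b\<in>minimal_nonstandard a lt. \<exists>w. u = b + w"
proof (induction "expo_deg u" arbitrary: u rule: less_induct)
  case less
  show ?case
  proof (cases "u \<in> minimal_nonstandard a lt")
    case True
    then show ?thesis by (intro bexI[of _ u] exI[of _ 0]) simp_all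
  next
    case False
    then obtain w s where w: "w \<in> nonstandard a lt" "u = w + s" "w \<noteq> u"
      using less.prems unfolding minimal_nonstandard_def by blast
    then have "expo_deg s \<noteq> 0" by (auto simp: expo_deg_def intro!: poly_mapping_eqI)
    then have "expo_deg w < expo_deg u" using w(2) by (simp add: expo_deg_add)
    from less.hyps[OF this w(1)] obtain b t where "b \<in> minimal_nonstandard a lt" "w = b + t" by blast
    then show ?thesis using w(2) by (intro bexI[of _ b] exI[of _ "t + s"]) (simp_all add: add.assoc)
  qed
qed

text \<open>The exponent of the normal form of \<open>mon u\<close>. For a term order the choice is
  unique: of two different exponents in a fibre the larger one is nonstandard.\<close>

definition fibre_min :: "('n::finite \<Rightarrow> int ^ 'd) \<Rightarrow> ('n expo \<Rightarrow> 'n expo \<Rightarrow> bool) \<Rightarrow> 'n expo \<Rightarrow> 'n expo" where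
  "fibre_min a lt u = (SOME v. expo_vec a v = expo_vec a u \<and> v \<notin> nonstandard a lt)"

text \<open>Equal degrees make each fibre finite, so a least element exists by a finite search,
  without well-foundedness of term orders.\<close>

lemma fibre_min:
  fixes a :: "'n::finite \<Rightarrow> int ^ 'd"
  assumes lt: "term_order lt"
    and graded: "\<forall>u v. expo_vec a u = expo_vec a v \<longrightarrow> expo_deg u = expo_deg v"
  shows "expo_vec a (fibre_min a lt u) = expo_vec a u" "fibre_min a lt u \<notin> nonstandard a lt"
proof -
  let ?A = "{v. expo_vec a v = expo_vec a u}"
  have "expo_deg v \<le> expo_deg u" if "v \<in> ?A" for v
    using graded that by (metis mem_Collect_eq order_refl)
  then have "?A \<subseteq> {v. expo_deg v \<le> expo_deg u}" by blast
  then have "finite ?A" using finite_expo_deg_le finite_subset by blast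
  moreover have "?A \<noteq> {}" by blast
  ultimately have "\<exists>v\<in>?A. \<forall>w\<in>?A. w \<noteq> v \<longrightarrow> lt v w" by (rule finite_has_lt_min[OF lt])
  then obtain v where v: "expo_vec a v = expo_vec a u" "\<forall>w\<in>?A. w \<noteq> v \<longrightarrow> lt v w"
    by (auto simp only: mem_Collect_eq)
  have "v \<notin> nonstandard a lt"
  proof
    assume "v \<in> nonstandard a lt"
    then obtain w where w: "expo_vec a w = expo_vec a v" "lt w v" unfolding nonstandard_def by blast
    then have "w \<noteq> v" using term_order_irrefl[OF lt] by blast
    then have "lt v w" using v w by simp
    then show False using term_order_irrefl[OF lt] term_order_trans[OF lt w(2)] by blast
  qed
  then have "\<exists>v. expo_vec a v = expo_vec a u \<and> v \<notin> nonstandard a lt" using v by blast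
  from someI_ex[OF this] show "expo_vec a (fibre_min a lt u) = expo_vec a u"
    "fibre_min a lt u \<notin> nonstandard a lt" by (simp_all add: fibre_min_def)
qed

lemma fibre_min_less:
  assumes "term_order lt" "\<forall>u v. expo_vec a u = expo_vec a v \<longrightarrow> expo_deg u = expo_deg v"
    and "u \<in> nonstandard a lt"
  shows "lt (fibre_min a lt u) u"
proof -
  note f = fibre_min[OF assms(1,2), where u = u]
  then have "fibre_min a lt u \<noteq> u" "\<not> lt u (fibre_min a lt u)"
    using assms(3) by (metis, force simp: nonstandard_def)
  then show ?thesis using term_order_total[OF assms(1)] by blast
qed

text \<open>The basis pairs each minimal generator of the initial ideal with its normal form. Both
  monomials have the same degree, so the bound on the generators bounds the binomials.\<close>

lemma reduced_groebner_basis_toric: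
  fixes a :: "'n::finite \<Rightarrow> int ^ 'd"
  assumes lt: "term_order lt"
    and graded: "\<forall>u v. expo_vec a u = expo_vec a v \<longrightarrow> expo_deg u = expo_deg v"
    and bound: "\<And>u. u \<in> minimal_nonstandard a lt \<Longrightarrow> expo_deg u \<le> D"
  shows "\<exists>G. is_reduced_groebner_basis lt (toric_ideal a :: ('n, 'k::field) mpoly set) G \<and>
    (\<forall>g\<in>G. is_binomial g \<and> total_degree g \<le> D)"
proof -
  let ?M = "minimal_nonstandard a lt" and ?s = "fibre_min a lt"
  define g where "g = (\<lambda>u. mon u - mon (?s u) :: ('n, 'k) mpoly)"
  have MN: "u \<in> nonstandard a lt" if "u \<in> ?M" for u using that by (simp add: minimal_nonstandard_def)
  note s = fibre_min[OF lt graded] and s_lt = fibre_min_less[OF lt graded MN]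
  have s_neq: "u \<noteq> ?s u" if "u \<in> ?M" for u using s_lt[OF that] term_order_irrefl[OF lt] by metis
  have keys_g: "keys (g u) = {u, ?s u}" if "u \<in> ?M" for u
    unfolding g_def by (rule keys_mon_diff[OF s_neq[OF that]])
  have lead_g: "lead_expo lt (g u) = u" if "u \<in> ?M" for u
    unfolding g_def by (rule lead_expo_mon_diff[OF lt s_lt[OF that]])
  have "is_reduced_groebner_basis lt (toric_ideal a) (g ` ?M)"
    unfolding is_reduced_groebner_basis_def
  proof (intro conjI ballI impI)
    \<comment> \<open>The degree bound supplies finiteness of the generating set, in place of
      Dickson's lemma.\<close>
    have "?M \<subseteq> {u. expo_deg u \<le> D}" using bound by blast
    then show "finite (g ` ?M)" using finite_expo_deg_le finite_subset by blast
    show "g ` ?M \<subseteq> toric_ideal a"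
      unfolding toric_ideal_def' g_def using s(1) by (intro image_subsetI hull_inc) force
    show "0 \<notin> g ` ?M" using keys_g by (metis imageE insert_not_empty keys_zero)
    have "{mon (lead_expo lt h) | h. h \<in> g ` ?M} = (mon ` ?M :: ('n, 'k) mpoly set)"
      using lead_g by (auto simp: image_iff) (metis lead_g)
    moreover have "ideal_gen (mon ` ?M) = {f :: ('n, 'k) mpoly. keys f \<subseteq> nonstandard a lt}"
    proof (rule ideal_gen_mon)
      fix u show "u \<in> nonstandard a lt \<longleftrightarrow> (\<exists>b\<in>?M. \<exists>w. u = b + w)"
        using nonstandard_above_minimal[of u a lt] nonstandard_add[OF lt MN] by fast
    qed
    ultimately show "initial_ideal lt (toric_ideal a :: ('n, 'k) mpoly set) = ideal_gen {mon (lead_expo lt h) | h. h \<in> g ` ?M}"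
      by (simp only: initial_ideal_toric[OF lt])
  next
    fix h assume "h \<in> g ` ?M"
    then obtain u where u: "u \<in> ?M" "h = g u" by blast
    then show "lookup h (lead_expo lt h) = 1"
      using lead_g[OF u(1)] s_neq[OF u(1)] by (auto simp: g_def lookup_minus mon_def lookup_single)
  next
    fix h h' v assume "h \<in> g ` ?M" "h' \<in> g ` ?M" and neq: "h \<noteq> h'" and v: "v \<in> keys h'"
    then obtain u u' where u: "u \<in> ?M" "h = g u" and u': "u' \<in> ?M" "h' = g u'" by blast
    show "\<nexists>w. v = lead_expo lt h + w"
    proof
      assume "\<exists>w. v = lead_expo lt h + w"
      then obtain w where w: "v = u + w" using lead_g[OF u(1)] u(2) by auto
      \<comment> \<open>A trailing monomial is standard, so no leading monomial divides it; only a
        leading monomial of \<open>h'\<close> remains, where minimality applies.\<close>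
      have "v \<noteq> ?s u'"
        using nonstandard_add[OF lt MN[OF u(1)]] s(2) unfolding w by metis
      then have "v = u'" using v keys_g[OF u'(1)] u'(2) by simp
      then have "u = u'" using u'(1) MN[OF u(1)] w unfolding minimal_nonstandard_def by blast
      then show False using neq u u' by simp
    qed
  qed
  moreover have "is_binomial h \<and> total_degree h \<le> D" if "h \<in> g ` ?M" for h
  proof -
    from that obtain u where u: "u \<in> ?M" "h = g u" by blast
    have "is_binomial h" unfolding is_binomial_def u(2) g_def using s_neq[OF u(1)] by blast
    moreover have "expo_deg (?s u) = expo_deg u" using graded s(1) by blast
    then have "total_degree h \<le> D"
      unfolding total_degree_def u(2) keys_g[OF u(1)] expo_deg_def[symmetric] using bound[OF u(1)] by simp
    ultimately show ?thesis by blast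
  qed
  ultimately show ?thesis by blast
qed

section \<open>Independence of the faces\<close>

lemma clear_denominators:
  fixes f :: "'a \<Rightarrow> rat"
  assumes "finite A"
  shows "\<exists>m>0. \<exists>k. \<forall>i\<in>A. of_int m * f i = of_int (k i)"
  using assms
proof (induction A rule: finite_induct)
  case empty
  show ?case by (intro exI[of _ 1]) simp
next
  case (insert x F)
  then obtain m k where m: "m > 0" "\<forall>i\<in>F. of_int m * f i = of_int (k i)" by blast
  obtain p q where pq: "f x = Fract p q" "q > 0" by (cases "f x") auto
  then have "of_int q * f x = of_int p" by (simp add: Fract_of_int_quotient)
  then have "of_int (m * q) * f i = of_int (if i = x then m * p else q * k i)" if "i \<in> insert x F" for i
    using that m(2) by (auto simp: mult_ac)
  then show ?case using m(1) pq(2) by (intro exI[of _ "m * q"] conjI exI[of _ "\<lambda>i. if i = x then m * p else q * k i"]) auto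
qed

lemma expo_vec_subset: "keys u \<subseteq> \<sigma> \<Longrightarrow> expo_vec a u = (\<Sum>i\<in>\<sigma>. int (lookup u i) *s a i)"
  unfolding expo_vec_def by (rule sum.mono_neutral_right) (auto simp: in_keys_iff)

lemma real_vec_sum: "real_vec (\<Sum>i\<in>A. f i) = (\<Sum>i\<in>A. real_vec (f i))"
  by (simp add: real_vec_def vec_eq_iff)

lemma real_vec_smult: "real_vec (k *s z) = real_of_int k *\<^sub>R real_vec z"
  by (simp add: real_vec_def vec_eq_iff)

text \<open>Of the fact that \<open>lt0\<close> induces \<open>\<Delta>\<close>, only \<open>face_least\<close> is needed: monomials supported on
  faces are standard. It already implies that the faces are linearly independent.\<close>

locale normal_config =
  fixes a :: "'n::finite \<Rightarrow> int ^ 'd::finite" and \<Delta> :: "'n set set"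
    and lt0 :: "'n expo \<Rightarrow> 'n expo \<Rightarrow> bool"
  assumes lt0: "term_order lt0"
    and complex: "simplicial_complex \<Delta>"
    and face_least: "\<And>u v. keys u \<in> \<Delta> \<Longrightarrow> expo_vec a v = expo_vec a u \<Longrightarrow> v \<noteq> u \<Longrightarrow> lt0 u v"
    and card_facet: "\<And>\<sigma>. \<sigma> \<in> facets \<Delta> \<Longrightarrow> card \<sigma> = CARD('d)"
    and cover: "cone_on a UNIV = (\<Union>\<sigma>\<in>facets \<Delta>. cone_on a \<sigma>)"
    and normal: "\<And>\<sigma>. \<sigma> \<in> facets \<Delta> \<Longrightarrow>
      nat_span_on a {i. real_vec (a i) \<in> cone_on a \<sigma>} =
      {z \<in> int_span_on a UNIV. real_vec z \<in> cone_on a \<sigma>}"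
    and graded: "graded_config a"
begin

lemma face_subset: "F \<in> \<Delta> \<Longrightarrow> F' \<subseteq> F \<Longrightarrow> F' \<in> \<Delta>"
  using complex by (auto simp: simplicial_complex_def)

lemma facet_face: "\<sigma> \<in> facets \<Delta> \<Longrightarrow> \<sigma> \<in> \<Delta>"
  by (simp add: facets_def)

lemma face_in_facet:
  assumes "F \<in> \<Delta>"
  obtains \<sigma> where "\<sigma> \<in> facets \<Delta>" "F \<subseteq> \<sigma>"
proof -
  obtain \<sigma> where "\<sigma> \<in> \<Delta>" "F \<subseteq> \<sigma>" "\<forall>\<tau>\<in>\<Delta>. \<sigma> \<subseteq> \<tau> \<longrightarrow> \<sigma> = \<tau>"
    using finite_has_maximal2[of \<Delta> F] assms by auto
  then show ?thesis using that[of \<sigma>] unfolding facets_def by blast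
qed

lemma face_unique: "keys u \<in> \<Delta> \<Longrightarrow> keys v \<in> \<Delta> \<Longrightarrow> expo_vec a u = expo_vec a v \<Longrightarrow> u = v"
  using face_least term_order_irrefl[OF lt0] term_order_trans[OF lt0] by metis

text \<open>The positive and the negative part of an integer relation on a face are two face
  monomials in one fibre, so \<open>face_unique\<close> identifies them.\<close>

lemma face_int_independent:
  assumes \<sigma>: "\<sigma> \<in> \<Delta>" and 0: "(\<Sum>i\<in>\<sigma>. k i *s a i) = 0" and i: "i \<in> \<sigma>"
  shows "k i = 0"
proof -
  define u v where "u = expo_of (\<lambda>i. if i \<in> \<sigma> then nat (k i) else 0)"
    and "v = expo_of (\<lambda>i. if i \<in> \<sigma> then nat (- k i) else 0)"
  have k: "keys u \<subseteq> \<sigma>" "keys v \<subseteq> \<sigma>" unfolding u_def v_def by (auto simp: keys_expo_of)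
  have "expo_vec a u - expo_vec a v = (\<Sum>i\<in>\<sigma>. k i *s a i)"
    unfolding expo_vec_subset[OF k(1)] expo_vec_subset[OF k(2)] sum_subtractf[symmetric]
    by (intro sum.cong) (auto simp: u_def v_def simp flip: vector_ssub_ldistrib vector_sub_rdistrib)
  then have "u = v" using 0 k \<sigma> face_subset by (intro face_unique) auto
  then have "lookup u i = lookup v i" by simp
  then show ?thesis using i by (simp add: u_def v_def)
qed

text \<open>The vectors of a facet are independent over the integers, hence over the rationals.
  There are \<open>CARD('d)\<close> of them, so they form a rational basis, and clearing
  denominators in the coordinates of \<open>z\<close> gives the claim.\<close>

lemma facet_spans:
  assumes \<sigma>: "\<sigma> \<in> facets \<Delta>"
  obtains m k where "m > 0" "m *s z = (\<Sum>i\<in>\<sigma>. k i *s a i)"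
proof -
  define r where "r = (\<lambda>v :: int ^ 'd. \<chi> j. rat_of_int (v $ j))"
  have r_sum: "r (\<Sum>i\<in>A. f i) = (\<Sum>i\<in>A. r (f i))" for f :: "'n \<Rightarrow> _" and A
    by (simp add: r_def vec_eq_iff)
  have r_smult: "r (k *s v) = of_int k *s r v" for k v by (simp add: r_def vec_eq_iff)
  have r_inj: "r v = r w \<longleftrightarrow> v = w" for v w by (simp add: r_def vec_eq_iff)
  have indep: "\<forall>i\<in>\<sigma>. c i = 0" if "(\<Sum>i\<in>\<sigma>. c i *s r (a i)) = 0" for c :: "'n \<Rightarrow> rat"
  proof -
    obtain m k where m: "m > 0" "\<forall>i\<in>\<sigma>. of_int m * c i = of_int (k i)"
      using clear_denominators[of \<sigma> c] by auto
    have "r (\<Sum>i\<in>\<sigma>. k i *s a i) = (\<Sum>i\<in>\<sigma>. (of_int m * c i) *s r (a i))"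
      unfolding r_sum r_smult using m(2) by (intro sum.cong) auto
    also have "\<dots> = of_int m *s (\<Sum>i\<in>\<sigma>. c i *s r (a i))"
      by (simp add: vec.scale_sum_right vector_smult_assoc)
    also have "\<dots> = r 0" by (simp add: that) (simp add: r_def vec_eq_iff)
    finally have "(\<Sum>i\<in>\<sigma>. k i *s a i) = 0" unfolding r_inj .
    then have "k i = 0" if "i \<in> \<sigma>" for i
      using face_int_independent[OF facet_face[OF \<sigma>]] that by blast
    then show ?thesis using m by force
  qed
  \<comment> \<open>Configurations are indexed families that may repeat vectors; injectivity on
    \<sigma> is needed to pass between sums over indices and sums over vectors, and to count the
    latter.\<close>
  have inj: "inj_on (\<lambda>i. r (a i)) \<sigma>"
  proof (rule inj_onI, rule ccontr)
    fix i j assume ij: "i \<in> \<sigma>" "j \<in> \<sigma>" "r (a i) = r (a j)" "i \<noteq> j"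
    have "(\<Sum>l\<in>\<sigma>. ((if l = i then 1 else 0) - (if l = j then 1 else 0)) *s r (a l))
        = (\<Sum>l\<in>\<sigma>. if l = i then r (a l) else 0) - (\<Sum>l\<in>\<sigma>. if l = j then r (a l) else 0)"
      unfolding sum_subtractf[symmetric] by (intro sum.cong) auto
    also have "\<dots> = 0" using ij by simp
    finally show False using indep ij by fastforce
  qed
  let ?S = "(\<lambda>i. r (a i)) ` \<sigma>"
  have "vec.independent ?S"
  proof
    assume "vec.dependent ?S"
    then obtain c where c: "\<exists>v\<in>?S. c v \<noteq> 0" "(\<Sum>v\<in>?S. c v *s v) = 0"
      by (auto simp: vec.dependent_finite)
    then have "(\<Sum>i\<in>\<sigma>. c (r (a i)) *s r (a i)) = 0" by (simp add: sum.reindex[OF inj])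
    from indep[OF this] show False using c(1) by blast
  qed
  then have "UNIV \<subseteq> vec.span ?S"
    by (intro vec.card_ge_dim_independent) (auto simp del: vec.dim_UNIV simp: vec_dim_card card_image[OF inj] card_facet[OF \<sigma>])
  then have "r z \<in> vec.span ?S" by blast
  then obtain c where "r z = (\<Sum>v\<in>?S. c v *s v)" by (auto simp: vec.span_finite)
  then have c: "r z = (\<Sum>i\<in>\<sigma>. c (r (a i)) *s r (a i))" by (simp add: sum.reindex[OF inj])
  obtain m k where m: "m > 0" "\<forall>i\<in>\<sigma>. of_int m * c (r (a i)) = of_int (k i)"
    using clear_denominators[of \<sigma> "\<lambda>i. c (r (a i))"] by auto
  have "r (m *s z) = (\<Sum>i\<in>\<sigma>. (of_int m * c (r (a i))) *s r (a i))"
    unfolding r_smult c by (simp add: vec.scale_sum_right vector_smult_assoc)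
  also have "\<dots> = r (\<Sum>i\<in>\<sigma>. k i *s a i)" unfolding r_sum r_smult using m(2) by (intro sum.cong) auto
  finally show ?thesis using that m(1) unfolding r_inj by blast
qed

section \<open>Real cones over the facets\<close>

lemma facet_real_spans:
  assumes \<sigma>: "\<sigma> \<in> facets \<Delta>"
  shows "span ((\<lambda>i. real_vec (a i)) ` \<sigma>) = UNIV"
proof -
  let ?S = "(\<lambda>i. real_vec (a i)) ` \<sigma>"
  \<comment> \<open>Some positive integer multiple of each unit vector is an integer combination of
    the facet, and real scalars allow division by that multiple.\<close>
  have "axis j 1 \<in> span ?S" for j
  proof -
    obtain m k where m: "m > 0" "m *s axis j 1 = (\<Sum>i\<in>\<sigma>. k i *s a i)" by (rule facet_spans[OF \<sigma>])
    have "real_of_int m *\<^sub>R axis j 1 = real_vec (m *s axis j 1)"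
      by (simp add: real_vec_def axis_def vec_eq_iff)
    also have "\<dots> = (\<Sum>i\<in>\<sigma>. real_of_int (k i) *\<^sub>R real_vec (a i))"
      unfolding m(2) real_vec_sum real_vec_smult ..
    also have "\<dots> \<in> span ?S" by (intro span_sum span_scale span_base) auto
    finally have "(1 / real_of_int m) *\<^sub>R (real_of_int m *\<^sub>R axis j 1) \<in> span ?S" by (rule span_scale)
    then show ?thesis using m(1) by simp
  qed
  then have "Basis \<subseteq> span ?S" by (auto simp: Basis_vec_def)
  then have "span Basis \<subseteq> span ?S" by (rule span_minimal) simp
  then show ?thesis by (simp add: top.extremum_uniqueI)
qed

lemma facet_real_independent:
  assumes \<sigma>: "\<sigma> \<in> facets \<Delta>" and 0: "(\<Sum>i\<in>\<sigma>. c i *\<^sub>R real_vec (a i)) = 0" and i: "i \<in> \<sigma>"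
  shows "c i = 0"
proof -
  let ?S = "(\<lambda>i. real_vec (a i)) ` \<sigma>"
  have dim: "dim (UNIV :: (real ^ 'd) set) = CARD('d)" by simp
  have "card ?S \<ge> CARD('d)"
    using span_card_ge_dim[of ?S UNIV] facet_real_spans[OF \<sigma>] dim by simp
  then have card: "card ?S = card \<sigma>" using card_image_le[of \<sigma>] card_facet[OF \<sigma>] by (metis finite le_antisym)
  then have inj: "inj_on (\<lambda>i. real_vec (a i)) \<sigma>" by (intro eq_card_imp_inj_on) auto
  have "independent ?S"
    by (rule card_le_dim_spanning[of _ UNIV])
      (use facet_real_spans[OF \<sigma>] card card_facet[OF \<sigma>] in auto)
  moreover define c' where "c' = (\<lambda>v. c (the_inv_into \<sigma> (\<lambda>i. real_vec (a i)) v))"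
  have "(\<Sum>v\<in>?S. c' v *\<^sub>R v) = 0"
    using 0 by (simp add: sum.reindex[OF inj] c'_def the_inv_into_f_f[OF inj])
  ultimately have "c' (real_vec (a i)) = 0" using i by (auto simp: dependent_finite)
  then show ?thesis using i by (simp add: c'_def the_inv_into_f_f[OF inj])
qed

text \<open>By real independence the nonnegative coefficients that witness membership in the cone
  agree with the rational ones of \<open>facet_spans\<close>, which are therefore
  nonnegative.\<close>

lemma facet_cone_rep:
  assumes \<sigma>: "\<sigma> \<in> facets \<Delta>" and z: "real_vec z \<in> cone_on a \<sigma>"
  obtains m u where "m > 0" "keys u \<subseteq> \<sigma>" "int m *s z = expo_vec a u"
proof -
  obtain c where c: "real_vec z = (\<Sum>i\<in>\<sigma>. c i *\<^sub>R real_vec (a i))" "\<forall>i\<in>\<sigma>. 0 \<le> c i"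
    using z unfolding cone_on_def by blast
  obtain m k where m: "m > 0" "m *s z = (\<Sum>i\<in>\<sigma>. k i *s a i)" by (rule facet_spans[OF \<sigma>])
  have "(\<Sum>i\<in>\<sigma>. (m * c i - k i) *\<^sub>R real_vec (a i))
      = m *\<^sub>R (\<Sum>i\<in>\<sigma>. c i *\<^sub>R real_vec (a i)) - (\<Sum>i\<in>\<sigma>. real_of_int (k i) *\<^sub>R real_vec (a i))"
    by (simp add: scaleR_sum_right sum_subtractf algebra_simps)
  also have "\<dots> = real_vec (m *s z) - real_vec (\<Sum>i\<in>\<sigma>. k i *s a i)"
    unfolding c(1)[symmetric] real_vec_sum real_vec_smult ..
  also have "\<dots> = 0" using m(2) by simp
  finally have eq: "m * c i = k i" if "i \<in> \<sigma>" for i using facet_real_independent[OF \<sigma>] that by force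
  have k: "k i \<ge> 0" if "i \<in> \<sigma>" for i
  proof -
    have "0 \<le> real_of_int m * c i" using m(1) c(2) that by simp
    then show ?thesis using eq[OF that] by simp
  qed
  define u where "u = expo_of (\<lambda>i. if i \<in> \<sigma> then nat (k i) else 0)"
  have u: "keys u \<subseteq> \<sigma>" by (auto simp: u_def keys_expo_of)
  have "int (nat m) *s z = expo_vec a u"
    unfolding expo_vec_subset[OF u] using m k by (simp add: u_def)
  then show ?thesis using that[of "nat m" u] u m(1) by simp
qed

text \<open>The functional \<open>c\<close> defining the hyperplane takes the same value
  \<open>b\<close> on every vector, so on the vector of a monomial it is \<open>b\<close> times the
  degree.\<close>

lemma expo_deg_fibre:
  assumes "expo_vec a u = expo_vec a v"
  shows "expo_deg u = expo_deg v"
proof -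
  obtain c b where c: "c \<noteq> 0" "affine hull (range (\<lambda>i. real_vec (a i))) = {x. c \<bullet> x = b}"
    using graded unfolding graded_config_def by blast
  then have cb: "c \<bullet> real_vec (a i) = b" for i using hull_subset[of "range (\<lambda>i. real_vec (a i))" affine] by auto
  obtain F where "F \<in> \<Delta>" using complex by (auto simp: simplicial_complex_def)
  then obtain \<sigma> where \<sigma>: "\<sigma> \<in> facets \<Delta>" by (rule face_in_facet)
  \<comment> \<open>Otherwise \<open>c\<close> would be orthogonal to a facet that spans the whole
    space, and so to itself.\<close>
  have "b \<noteq> 0"
  proof
    assume b: "b = 0"
    have "c \<bullet> x = 0" if "x \<in> span ((\<lambda>i. real_vec (a i)) ` \<sigma>)" for x
      using that by (rule span_induct) (use cb b in \<open>auto simp: subspace_def inner_add_right\<close>)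
    then have "c \<bullet> c = 0" using facet_real_spans[OF \<sigma>] by blast
    then show False using c(1) by simp
  qed
  moreover have "c \<bullet> real_vec (expo_vec a w) = real (expo_deg w) * b" for w
    by (simp add: expo_vec_def real_vec_sum real_vec_smult inner_sum_right cb expo_deg_def sum_distrib_right)
  ultimately show ?thesis using assms by (metis mult_right_cancel of_nat_eq_iff)
qed

end

section \<open>Powers of monomials and a common denominator\<close>

definition scale_expo :: "nat \<Rightarrow> 'n::finite expo \<Rightarrow> 'n expo" where
  "scale_expo k u = expo_of (\<lambda>i. k * lookup u i)"

lemma lookup_scale_expo [simp]: "lookup (scale_expo k u) i = k * lookup u i"
  by (simp add: scale_expo_def)

lemma keys_scale_expo: "k > 0 \<Longrightarrow> keys (scale_expo k u) = keys u"
  by (auto simp: in_keys_iff)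

lemma expo_vec_scale_expo: "expo_vec a (scale_expo k u) = int k *s expo_vec a u"
  by (simp add: expo_vec_def vec.scale_sum_right vector_smult_assoc sum_distrib_left vec_eq_iff mult_ac)

lemma expo_deg_scale_expo: "expo_deg (scale_expo k u) = k * expo_deg u"
  by (simp add: expo_deg_def sum_distrib_left)

lemma scale_expo_inj: "k > 0 \<Longrightarrow> scale_expo k u = scale_expo k v \<Longrightarrow> u = v"
  by (rule poly_mapping_eqI) (metis lookup_scale_expo mult_left_cancel neq0_conv)

lemma cone_onI:
  assumes m: "m > 0" and u: "keys u \<subseteq> \<sigma>" and z: "int m *s z = expo_vec a u"
  shows "real_vec z \<in> cone_on a \<sigma>"
proof -
  have "real m *\<^sub>R real_vec z = real_vec (int m *s z)" by (simp add: real_vec_smult)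
  also have "\<dots> = (\<Sum>i\<in>\<sigma>. real (lookup u i) *\<^sub>R real_vec (a i))"
    unfolding z expo_vec_subset[OF u] real_vec_sum real_vec_smult by simp
  finally have "(1 / real m) *\<^sub>R (real m *\<^sub>R real_vec z)
      = (\<Sum>i\<in>\<sigma>. (real (lookup u i) / real m) *\<^sub>R real_vec (a i))"
    by (simp add: scaleR_sum_right)
  then have "real_vec z = (\<Sum>i\<in>\<sigma>. (real (lookup u i) / real m) *\<^sub>R real_vec (a i))"
    using m by simp
  then show ?thesis unfolding cone_on_def by (intro CollectI exI[of _ "\<lambda>i. real (lookup u i) / real m"]) simp
qed

text \<open>Each vector lies in the cone of some facet, so a positive multiple \<open>m i\<close> of
  it comes from a face monomial. Rescaling to a common multiple \<open>M\<close> keeps the supports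
  and lets the projection below be additive with integer exponents.\<close>

lemma (in normal_config) vertex_combinations:
  obtains M C where "M > 0" "\<And>i. keys (C i) \<in> \<Delta>" "\<And>i. expo_vec a (C i) = int M *s a i"
proof -
  have "\<exists>m u. m > 0 \<and> keys u \<in> \<Delta> \<and> int m *s a i = expo_vec a u" for i
  proof -
    have "keys (Poly_Mapping.single i 1 :: 'n expo) \<subseteq> UNIV" by simp
    moreover have "int 1 *s a i = expo_vec a (Poly_Mapping.single i 1)"
      by (subst expo_vec_subset[of _ "{i}"]) auto
    ultimately have "real_vec (a i) \<in> cone_on a UNIV" by (intro cone_onI[of 1]) auto
    then obtain \<sigma> where \<sigma>: "\<sigma> \<in> facets \<Delta>" "real_vec (a i) \<in> cone_on a \<sigma>" unfolding cover by blast
    from facet_cone_rep[OF this] obtain m u where "m > 0" "keys u \<subseteq> \<sigma>" "int m *s a i = expo_vec a u" .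
    then show ?thesis using face_subset[OF facet_face[OF \<sigma>(1)]] by blast
  qed
  then obtain m u where mu: "\<And>i. m i > 0" "\<And>i. keys (u i) \<in> \<Delta>" "\<And>i. int (m i) *s a i = expo_vec a (u i)"
    by metis
  define M where "M = (\<Prod>i\<in>UNIV. m i)"
  have M: "M > 0" using mu(1) by (simp add: M_def prod_pos)
  have dvd: "m i dvd M" for i unfolding M_def by (rule dvd_prodI) auto
  show ?thesis
  proof (rule that[of M "\<lambda>i. scale_expo (M div m i) (u i)"])
    fix i
    have "M div m i > 0" using M dvd mu(1) by (meson div_greater_zero_iff dvd_imp_le)
    then show "keys (scale_expo (M div m i) (u i)) \<in> \<Delta>" using mu(2) by (simp add: keys_scale_expo)
    have "expo_vec a (scale_expo (M div m i) (u i)) = int (M div m i * m i) *s a i"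
      by (simp add: expo_vec_scale_expo mu(3)[symmetric] vector_smult_assoc)
    then show "expo_vec a (scale_expo (M div m i) (u i)) = int M *s a i" using dvd by simp
  qed (use M in simp)
qed

section \<open>The refined term order\<close>

locale projected_config = normal_config a \<Delta> lt0
  for a :: "'n::finite \<Rightarrow> int ^ 'd::finite" and \<Delta> lt0 +
  fixes M :: nat and C :: "'n \<Rightarrow> 'n expo"
  assumes M_pos: "M > 0"
    and keys_C: "keys (C i) \<in> \<Delta>"
    and expo_vec_C: "expo_vec a (C i) = int M *s a i"
begin

text \<open>The monoid homomorphism that replaces each variable \<open>x_i\<close> by the monomial
  with exponent \<open>C i\<close>; it multiplies vectors and degrees by \<open>M\<close>.\<close>

definition proj :: "'n expo \<Rightarrow> 'n expo" where
  "proj u = expo_of (\<lambda>j. \<Sum>i\<in>UNIV. lookup u i * lookup (C i) j)"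

definition vertex_deg :: "'n expo \<Rightarrow> nat" where
  "vertex_deg u = (\<Sum>i\<in>\<Union>\<Delta>. lookup u i)"

definition less_expo :: "'n expo \<Rightarrow> 'n expo \<Rightarrow> bool" where
  "less_expo u v \<longleftrightarrow> lt0 (proj u) (proj v) \<or>
     proj u = proj v \<and> (vertex_deg v < vertex_deg u \<or> vertex_deg u = vertex_deg v \<and> lt0 u v)"

lemma lookup_proj [simp]: "lookup (proj u) j = (\<Sum>i\<in>UNIV. lookup u i * lookup (C i) j)"
  by (simp add: proj_def)

lemma proj_add: "proj (u + v) = proj u + proj v"
  by (rule poly_mapping_eqI) (simp add: lookup_add distrib_right sum.distrib)

lemma proj_scale_expo: "proj (scale_expo k u) = scale_expo k (proj u)"
  by (rule poly_mapping_eqI) (simp add: sum_distrib_left mult_ac)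

lemma expo_vec_proj: "expo_vec a (proj u) = int M *s expo_vec a u"
proof -
  have "expo_vec a (proj u) = (\<Sum>j\<in>UNIV. \<Sum>i\<in>UNIV. int (lookup u i) *s (int (lookup (C i) j) *s a j))"
    unfolding expo_vec_def by (simp add: vec.scale_sum_left vector_smult_assoc)
      (simp add: vec_eq_iff sum_distrib_right)
  also have "\<dots> = (\<Sum>i\<in>UNIV. \<Sum>j\<in>UNIV. int (lookup u i) *s (int (lookup (C i) j) *s a j))"
    by (rule sum.swap)
  also have "\<dots> = (\<Sum>i\<in>UNIV. int (lookup u i) *s expo_vec a (C i))"
    unfolding expo_vec_def by (simp add: vec_eq_iff sum_distrib_left mult.assoc)
  also have "\<dots> = int M *s expo_vec a u"
    unfolding expo_vec_C by (simp add: expo_vec_def vec_eq_iff sum_distrib_left mult_ac)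
  finally show ?thesis .
qed

lemma expo_vec_proj_cong: "expo_vec a u = expo_vec a v \<Longrightarrow> expo_vec a (proj u) = expo_vec a (proj v)"
  by (simp add: expo_vec_proj)

text \<open>\<open>proj u\<close> lies in the fibre of the \<open>M\<close>-th power of
  \<open>u\<close>, and degree is constant on fibres.\<close>

lemma expo_deg_proj: "expo_deg (proj u) = M * expo_deg u"
  using expo_deg_fibre[of "proj u" "scale_expo M u"]
  by (simp add: expo_vec_proj expo_vec_scale_expo expo_deg_scale_expo)

lemma keys_proj: "keys (proj u) = (\<Union>i\<in>keys u. keys (C i))"
  by (force simp: in_keys_iff)

lemma keys_proj_vertices: "keys (proj u) \<subseteq> \<Union>\<Delta>"
  using keys_C by (auto simp: keys_proj)

text \<open>\<open>C i\<close> comes from an arbitrary choice of facet, but at a vertex the power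
  \<open>M\<close> of the variable is a face monomial in the same fibre, so uniqueness forces the
  value.\<close>

lemma C_vertex:
  assumes "i \<in> \<Union>\<Delta>"
  shows "C i = scale_expo M (Poly_Mapping.single i 1)"
proof (rule face_unique[OF keys_C])
  show "keys (scale_expo M (Poly_Mapping.single i 1)) \<in> \<Delta>"
    using assms face_subset by (auto simp: keys_scale_expo[OF M_pos])
  have "expo_vec a (Poly_Mapping.single i 1) = a i" by (subst expo_vec_subset[of _ "{i}"]) auto
  then show "expo_vec a (C i) = expo_vec a (scale_expo M (Poly_Mapping.single i 1))"
    by (simp add: expo_vec_C expo_vec_scale_expo)
qed

lemma proj_ge: "i \<in> \<Union>\<Delta> \<Longrightarrow> M * lookup u i \<le> lookup (proj u) i"
  using member_le_sum[of i UNIV "\<lambda>l. lookup u l * lookup (C l) i"] by (simp add: C_vertex mult.commute)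

lemma proj_vertices:
  assumes "keys u \<subseteq> \<Union>\<Delta>"
  shows "proj u = scale_expo M u"
proof (rule poly_mapping_eqI)
  fix j
  have "lookup (proj u) j = (\<Sum>i\<in>UNIV. if i = j then M * lookup u i else 0)"
    unfolding lookup_proj
  proof (intro sum.cong refl)
    fix i
    show "lookup u i * lookup (C i) j = (if i = j then M * lookup u i else 0)"
    proof (cases "i \<in> keys u")
      case True
      then have "i \<in> \<Union>\<Delta>" using assms by blast
      then show ?thesis by (subst C_vertex) (simp_all add: lookup_single when_def)
    next
      case False
      then have "lookup u i = 0" by (simp add: in_keys_iff)
      then show ?thesis by auto
    qed
  qed
  then show "lookup (proj u) j = lookup (scale_expo M u) j" by simp
qed

lemma vertex_deg_le: "vertex_deg u \<le> expo_deg u"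
  unfolding vertex_deg_def expo_deg_def by (rule sum_mono2) auto

lemma vertex_deg_eq_iff: "vertex_deg u = expo_deg u \<longleftrightarrow> keys u \<subseteq> \<Union>\<Delta>"
proof -
  have "expo_deg u = vertex_deg u + (\<Sum>i\<in>- \<Union>\<Delta>. lookup u i)"
    unfolding vertex_deg_def expo_deg_def
    using sum.subset_diff[of "\<Union>\<Delta>" UNIV "lookup u"] by (simp add: Compl_eq_Diff_UNIV)
  then have "vertex_deg u = expo_deg u \<longleftrightarrow> (\<forall>i\<in>- \<Union>\<Delta>. lookup u i = 0)" by simp
  then show ?thesis by (auto simp: in_keys_iff)
qed

lemma term_order_less_expo: "term_order less_expo"
  unfolding term_order_def
proof (intro conjI allI impI)
  note irr = term_order_irrefl[OF lt0] and tr = term_order_trans[OF lt0]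
    and tot = term_order_total[OF lt0] and add = term_order_add[OF lt0]
  show "irreflp less_expo" using irr by (auto simp: irreflp_def less_expo_def)
  show "transp less_expo"
  proof (rule transpI)
    fix u v w assume "less_expo u v" "less_expo v w"
    moreover have "lt0 u v \<Longrightarrow> lt0 v w \<Longrightarrow> lt0 u w"
      "lt0 (proj u) (proj v) \<Longrightarrow> lt0 (proj v) (proj w) \<Longrightarrow> lt0 (proj u) (proj w)"
      by (fact tr)+
    ultimately show "less_expo u w" unfolding less_expo_def by auto
  qed
  show "totalp less_expo"
    unfolding totalp_on_def less_expo_def using tot by (metis linorder_neqE_nat)
  \<comment> \<open>The tie-break prefers larger vertex degrees and could place \<open>u\<close>
    below 0. It is never reached: \<open>proj u\<close> has degree \<open>M * expo_deg u\<close>,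
    which is positive, so the first comparison decides.\<close>
  show "less_expo 0 u" if "u \<noteq> 0" for u
  proof -
    have "expo_deg u \<noteq> 0" using that by (auto simp: expo_deg_def intro!: poly_mapping_eqI)
    then have "expo_deg (proj u) \<noteq> 0" using M_pos by (simp add: expo_deg_proj)
    moreover have "expo_deg (0 :: 'n expo) = 0" by (simp add: expo_deg_def)
    ultimately have "proj u \<noteq> 0" by metis
    moreover have "proj 0 = 0" by (rule poly_mapping_eqI) simp
    ultimately show ?thesis using term_order_zero[OF lt0] by (simp add: less_expo_def)
  qed
  have deg: "vertex_deg (u + w) = vertex_deg u + vertex_deg w" for u w
    by (simp add: vertex_deg_def lookup_add sum.distrib)
  show "less_expo (u + w) (v + w)" if "less_expo u v" for u v w
    using that unfolding less_expo_def proj_add deg by (auto intro: add)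
qed

section \<open>The initial complex of the refined order\<close>

abbreviation "nonstd \<equiv> nonstandard a less_expo"

lemma face_proj_less:
  assumes "keys (proj v) \<in> \<Delta>" "expo_vec a v = expo_vec a u" "proj v \<noteq> proj u"
  shows "less_expo v u"
  using face_least[OF assms(1), of "proj u"] assms(3) expo_vec_proj_cong[OF assms(2)]
  by (simp add: less_expo_def)

text \<open>All of the degree of \<open>w\<close> lies in the vertices, the maximum possible in its
  fibre. If \<open>u\<close> attained it too, both projections would be \<open>M\<close>-th powers,
  and their equality would give \<open>w = u\<close>.\<close>

lemma vertices_less:
  assumes w: "keys w \<subseteq> \<Union>\<Delta>" and vec: "expo_vec a w = expo_vec a u" and proj: "proj w = proj u"
    and neq: "w \<noteq> u"
  shows "less_expo w u"
proof -
  have "vertex_deg w = expo_deg u" using w expo_deg_fibre[OF vec] vertex_deg_eq_iff by metis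
  moreover have "vertex_deg u \<noteq> expo_deg u"
  proof
    assume "vertex_deg u = expo_deg u"
    then have "scale_expo M w = scale_expo M u"
      using proj proj_vertices w vertex_deg_eq_iff by metis
    then show False using neq scale_expo_inj[OF M_pos] by blast
  qed
  ultimately show ?thesis using proj vertex_deg_le[of u] by (simp add: less_expo_def)
qed

lemma face_standard:
  assumes u: "keys u \<in> \<Delta>"
  shows "u \<notin> nonstd"
proof
  assume "u \<in> nonstd"
  then obtain v where v: "expo_vec a v = expo_vec a u" "less_expo v u" unfolding nonstandard_def by blast
  have uV: "keys u \<subseteq> \<Union>\<Delta>" using u by blast
  have "keys (proj u) \<in> \<Delta>" using u by (simp add: proj_vertices[OF uV] keys_scale_expo[OF M_pos])
  then have "less_expo u v"
    using face_proj_less[of u v] vertices_less[OF uV, of v] v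
      term_order_irrefl[OF term_order_less_expo] by metis
  then show False
    using v(2) term_order_irrefl[OF term_order_less_expo] term_order_trans[OF term_order_less_expo] by metis
qed

text \<open>Normality writes \<open>z\<close> with vectors lying in the cone of \<sigma>, and the
  projection sends each of the corresponding variables to a monomial on \<sigma>.\<close>

lemma normal_lift:
  assumes \<sigma>: "\<sigma> \<in> facets \<Delta>" and z: "real_vec z \<in> cone_on a \<sigma>" "z \<in> int_span_on a UNIV"
  obtains v where "expo_vec a v = z" "keys (proj v) \<subseteq> \<sigma>"
proof -
  let ?T = "{i. real_vec (a i) \<in> cone_on a \<sigma>}"
  have "z \<in> nat_span_on a ?T" using normal[OF \<sigma>] z by blast
  then obtain c where c: "z = (\<Sum>i\<in>?T. int (c i) *s a i)" unfolding nat_span_on_def by blast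
  define v where "v = expo_of (\<lambda>i. if i \<in> ?T then c i else 0)"
  have v: "keys v \<subseteq> ?T" by (auto simp: v_def keys_expo_of)
  have "expo_vec a v = z" unfolding expo_vec_subset[OF v] c by (simp add: v_def)
  \<comment> \<open>\<open>C i\<close> may have been chosen from another facet. Suitable powers of
    it and of the representation on \<sigma> are face monomials in one fibre, hence equal, so the
    supports agree.\<close>
  moreover have "keys (C i) \<subseteq> \<sigma>" if i: "real_vec (a i) \<in> cone_on a \<sigma>" for i
  proof -
    obtain m u where m: "m > 0" and u: "keys u \<subseteq> \<sigma>" "int m *s a i = expo_vec a u"
      by (rule facet_cone_rep[OF \<sigma> i])
    have "scale_expo m (C i) = scale_expo M u"
    proof (rule face_unique)
      show "keys (scale_expo m (C i)) \<in> \<Delta>" using keys_C m by (simp add: keys_scale_expo)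
      show "keys (scale_expo M u) \<in> \<Delta>"
        using face_subset[OF facet_face[OF \<sigma>] u(1)] by (simp add: keys_scale_expo[OF M_pos])
      show "expo_vec a (scale_expo m (C i)) = expo_vec a (scale_expo M u)"
        by (simp add: expo_vec_scale_expo expo_vec_C u(2)[symmetric] vector_smult_assoc mult.commute)
    qed
    then show ?thesis using u(1) keys_scale_expo m M_pos by metis
  qed
  ultimately show ?thesis using that[of v] v by (auto simp: keys_proj)
qed

lemma expo_vec_int_span: "expo_vec a u - expo_vec a v \<in> int_span_on a UNIV"
  unfolding int_span_on_def expo_vec_def
  by (intro CollectI exI[of _ "\<lambda>i. int (lookup u i) - int (lookup v i)"])
    (simp add: vec_eq_iff sum_subtractf left_diff_distrib)

text \<open>The vector of \<open>u\<close> lies in the cone of some facet, and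
  \<open>normal_lift\<close> supplies a monomial of the same fibre with face projection, which is
  smaller.\<close>

lemma nonface_proj_nonstandard:
  assumes "keys (proj u) \<notin> \<Delta>"
  shows "u \<in> nonstd"
proof -
  let ?z = "expo_vec a u"
  have "real_vec ?z \<in> cone_on a UNIV" by (rule cone_onI[of 1 u]) auto
  then obtain \<sigma> where \<sigma>: "\<sigma> \<in> facets \<Delta>" "real_vec ?z \<in> cone_on a \<sigma>" unfolding cover by blast
  have "expo_vec a 0 = 0" by (simp add: expo_vec_def)
  then have "?z \<in> int_span_on a UNIV" using expo_vec_int_span[of u 0] by simp
  then obtain v where v: "expo_vec a v = ?z" "keys (proj v) \<subseteq> \<sigma>" by (rule normal_lift[OF \<sigma>])
  have "keys (proj v) \<in> \<Delta>" using face_subset[OF facet_face[OF \<sigma>(1)] v(2)] .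
  moreover have "proj v \<noteq> proj u" using calculation assms by metis
  ultimately have "less_expo v u" using v(1) by (intro face_proj_less)
  then show ?thesis using v(1) unfolding nonstandard_def by blast
qed

lemma nonface_nonstandard:
  assumes u: "keys u \<notin> \<Delta>"
  obtains k where "scale_expo k u \<in> nonstd"
proof (cases "keys (proj u) \<in> \<Delta>")
  case False
  moreover have "scale_expo 1 u = u" by (rule poly_mapping_eqI) simp
  ultimately show ?thesis using that[of 1] nonface_proj_nonstandard by simp
next
  case True
  \<comment> \<open>Here \<open>u\<close> is not a face monomial although its projection is. The
    \<open>M\<close>-th power of \<open>u\<close> and \<open>proj u\<close> have the same vector and
    the same projection, so the tie-break decides.\<close>
  have "less_expo (proj u) (scale_expo M u)"
  proof (rule vertices_less[OF keys_proj_vertices])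
    show "expo_vec a (proj u) = expo_vec a (scale_expo M u)" by (simp add: expo_vec_proj expo_vec_scale_expo)
    show "proj (proj u) = proj (scale_expo M u)"
      by (simp add: proj_vertices[OF keys_proj_vertices] proj_scale_expo)
    show "proj u \<noteq> scale_expo M u" using True u keys_scale_expo[OF M_pos] by metis
  qed
  moreover have "expo_vec a (proj u) = expo_vec a (scale_expo M u)"
    by (simp add: expo_vec_proj expo_vec_scale_expo)
  ultimately have "scale_expo M u \<in> nonstd" unfolding nonstandard_def by blast
  then show ?thesis by (rule that)
qed

text \<open>One inclusion holds because face monomials are standard and Stanley-Reisner ideals are
  radical. For the other, every nonface monomial has a nonstandard power, and the radical is an
  ideal, so terms can be treated separately.\<close>

lemma initial_complex_less_expo:
  "is_initial_complex less_expo (toric_ideal a :: ('n, 'k::field) mpoly set) \<Delta>"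
  unfolding is_initial_complex_def initial_ideal_toric[OF term_order_less_expo]
    stanley_reisner_ideal_eq[OF complex]
proof (intro conjI complex equalityI subsetI)
  fix f :: "('n, 'k) mpoly" assume "f \<in> radical {f. keys f \<subseteq> nonstd}"
  then obtain k where "keys (f ^ k) \<subseteq> nonstd" unfolding radical_def by blast
  then have "\<forall>u\<in>keys (f ^ k). keys u \<notin> \<Delta>" using face_standard by blast
  then show "f \<in> {f. \<forall>u\<in>keys f. keys u \<notin> \<Delta>}"
    using stanley_reisner_ideal_radical[OF lt0 _ _ complex] by blast
next
  fix f :: "('n, 'k) mpoly" assume f: "f \<in> {f. \<forall>u\<in>keys f. keys u \<notin> \<Delta>}"
  have I: "is_ideal {f :: ('n, 'k) mpoly. keys f \<subseteq> nonstd}"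
    unfolding initial_ideal_toric[OF term_order_less_expo, symmetric] initial_ideal_def
    by (rule is_ideal_ideal_gen)
  have "(\<Sum>u\<in>keys f. Poly_Mapping.single u (lookup f u)) \<in> radical {f. keys f \<subseteq> nonstd}"
  proof (rule is_ideal_sum[OF is_ideal_radical[OF I]])
    fix u assume "u \<in> keys f"
    then obtain k where k: "scale_expo k u \<in> nonstd" using f nonface_nonstandard by blast
    have "mon u ^ k \<in> {f :: ('n, 'k) mpoly. keys f \<subseteq> nonstd}"
      unfolding mon_power scale_expo_def[symmetric] using k by (simp add: mon_def)
    then have "(mon u :: ('n, 'k) mpoly) \<in> radical {f. keys f \<subseteq> nonstd}" unfolding radical_def by blast
    then show "Poly_Mapping.single u (lookup f u) \<in> radical {f. keys f \<subseteq> nonstd}"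
      using is_ideal_mult_left[OF is_ideal_radical[OF I]] single_eq_mult_mon[of 0 u] by (metis add_0)
  qed simp
  then show "f \<in> radical {f. keys f \<subseteq> nonstd}" by (simp add: sum_single_lookup)
qed

section \<open>The degree bound\<close>

text \<open>A minimal nonface with more than \<open>CARD('d)\<close> elements would be a facet plus
  one element \<open>t\<close>. The linear relation between \<open>t\<close> and the facet then
  contradicts either uniqueness of face monomials or the grading.\<close>

lemma small_nonface:
  assumes "\<tau> \<notin> \<Delta>"
  obtains \<rho> where "\<rho> \<subseteq> \<tau>" "\<rho> \<notin> \<Delta>" "card \<rho> \<le> CARD('d)"
proof -
  let ?N = "{\<rho>. \<rho> \<subseteq> \<tau> \<and> \<rho> \<notin> \<Delta>}"
  obtain \<rho> where \<rho>: "\<rho> \<in> ?N" "\<forall>\<rho>'\<in>?N. \<rho>' \<subseteq> \<rho> \<longrightarrow> \<rho> = \<rho>'"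
    using finite_has_minimal2[of ?N \<tau>] assms by auto
  then have proper: "\<rho>' \<in> \<Delta>" if "\<rho>' \<subset> \<rho>" for \<rho>' using that by blast
  have "card \<rho> \<le> CARD('d)"
  proof (rule ccontr)
    assume "\<not> card \<rho> \<le> CARD('d)"
    then have card: "CARD('d) < card \<rho>" by simp
    then obtain t where t: "t \<in> \<rho>" by fastforce
    then obtain \<sigma> where \<sigma>: "\<sigma> \<in> facets \<Delta>" "\<rho> - {t} \<subseteq> \<sigma>" using face_in_facet[OF proper[of "\<rho> - {t}"]] by blast
    have "card (\<rho> - {t}) \<ge> card \<sigma>" using card t card_facet[OF \<sigma>(1)] by simp
    then have \<sigma>_eq: "\<sigma> = \<rho> - {t}" using card_seteq[OF _ \<sigma>(2)] by simp
    obtain m k where m: "m > 0" "m *s a t = (\<Sum>i\<in>\<sigma>. k i *s a i)" by (rule facet_spans[OF \<sigma>(1)])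
    \<comment> \<open>The two sides of the relation after moving the terms with negative
      coefficients next to \<open>t\<close>.\<close>
    define u v where "u = expo_of (\<lambda>i. if i = t then nat m else if i \<in> \<sigma> then nat (- k i) else 0)"
      and "v = expo_of (\<lambda>i. if i \<in> \<sigma> then nat (k i) else 0)"
    have u: "keys u \<subseteq> insert t \<sigma>" and v: "keys v \<subseteq> \<sigma>"
      unfolding u_def v_def by (auto simp: keys_expo_of)
    have t\<sigma>: "t \<notin> \<sigma>" using \<sigma>_eq by blast
    have "(\<Sum>i\<in>\<sigma>. int (lookup u i) *s a i) = (\<Sum>i\<in>\<sigma>. int (lookup v i) *s a i) - (\<Sum>i\<in>\<sigma>. k i *s a i)"
      unfolding sum_subtractf[symmetric] using t\<sigma>
      by (intro sum.cong) (auto simp: u_def v_def simp flip: vector_sub_rdistrib)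
    then have uv: "expo_vec a u = expo_vec a v"
      unfolding expo_vec_subset[OF u] expo_vec_subset[OF v] using t\<sigma> m by (simp add: u_def)
    have "lookup u t \<noteq> lookup v t" using m(1) t\<sigma> by (simp add: u_def v_def)
    then have neq: "u \<noteq> v" by metis
    show False
    \<comment> \<open>Full support of \<open>u\<close> means that all \<open>k i\<close> are
      negative and \<open>v\<close> is 0, which equality of degrees excludes. Otherwise
      \<open>u\<close> is supported on a proper subset of \<rho>, which is a face.\<close>
    proof (cases "keys u = \<rho>")
      case True
      have "v = 0"
      proof (rule poly_mapping_eqI)
        fix i show "lookup v i = lookup 0 i"
        proof (cases "i \<in> \<sigma>")
          case True
          then have "i \<in> keys u" using \<open>keys u = \<rho>\<close> \<sigma>_eq by blast
          then have "lookup u i \<noteq> 0" by (simp add: in_keys_iff)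
          then show ?thesis using True t\<sigma> by (auto simp: u_def v_def split: if_splits)
        qed (simp add: v_def)
      qed
      then have "expo_deg u = 0" using expo_deg_fibre[OF uv] by (simp add: expo_deg_def)
      then have "u = 0" by (auto simp: expo_deg_def intro!: poly_mapping_eqI)
      then show False using neq \<open>v = 0\<close> by simp
    next
      case False
      then have "keys u \<in> \<Delta>" using proper u \<sigma>_eq t by blast
      moreover have "keys v \<in> \<Delta>" using face_subset[OF facet_face[OF \<sigma>(1)] v] .
      ultimately show False using face_unique uv neq by blast
    qed
  qed
  then show ?thesis using that \<rho>(1) by blast
qed

text \<open>Dividing by the vertices of \<open>\<sigma>\<close> as long as possible leaves a lattice point of the
  cone, which by normality is again the image of a monomial supported in the cone; the
  standard monomial has to attain this maximal vertex degree.\<close>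

lemma standard_vertex_divides:
  assumes v: "v \<notin> nonstd" and \<sigma>: "\<sigma> \<in> facets \<Delta>" and pv: "keys (proj v) \<subseteq> \<sigma>"
    and j: "j \<in> \<sigma>" "M \<le> lookup (proj v) j"
  shows "lookup v j \<noteq> 0"
proof
  assume v0: "lookup v j = 0"
  \<comment> \<open>The numbers \<open>lookup (proj v) i / M\<close> are the coordinates of the
    vector of \<open>v\<close> with respect to \<sigma>. \<open>e\<close> is their integral part;
    \<open>r\<close> gives the fractional part, a point of the half-open fundamental
    parallelepiped.\<close>
  define e where "e = expo_of (\<lambda>i. lookup (proj v) i div M)"
  define r where "r = expo_of (\<lambda>i. lookup (proj v) i mod M)"
  have pv_eq: "proj v = r + scale_expo M e"
    by (rule poly_mapping_eqI) (simp add: e_def r_def lookup_add)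
  then have r\<sigma>: "keys r \<subseteq> \<sigma>" and e\<sigma>: "keys e \<subseteq> \<sigma>"
    using pv by (auto simp: keys_expo_add keys_scale_expo[OF M_pos])
  have "int M *s (expo_vec a v - expo_vec a e) = expo_vec a r"
    using arg_cong[OF pv_eq, of "expo_vec a"]
    by (simp add: expo_vec_proj expo_vec_add expo_vec_scale_expo vector_ssub_ldistrib)
  then have "real_vec (expo_vec a v - expo_vec a e) \<in> cone_on a \<sigma>"
    by (rule cone_onI[OF M_pos r\<sigma>])
  then obtain w where w: "expo_vec a w = expo_vec a v - expo_vec a e" "keys (proj w) \<subseteq> \<sigma>"
    using normal_lift[OF \<sigma>] expo_vec_int_span by blast
  let ?v = "w + e"
  have vec: "expo_vec a ?v = expo_vec a v" by (simp add: expo_vec_add w)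
  have eV: "keys e \<subseteq> \<Union>\<Delta>" using e\<sigma> facet_face[OF \<sigma>] by blast
  have "keys (proj ?v) \<subseteq> \<sigma>"
    using w(2) e\<sigma> by (simp add: proj_add proj_vertices[OF eV] keys_expo_add keys_scale_expo[OF M_pos])
  then have "proj ?v = proj v"
    using face_subset[OF facet_face[OF \<sigma>]] pv expo_vec_proj_cong[OF vec] by (intro face_unique) auto
  moreover have "vertex_deg v < vertex_deg ?v"
    unfolding vertex_deg_def
  proof (rule sum_strict_mono_ex1)
    \<comment> \<open>A vertex variable of \<open>v\<close> contributes \<open>M\<close> times its
      exponent to the projection, so the integral part \<open>e\<close> dominates \<open>v\<close>
      on vertices. At \<open>j\<close> this is strict, since \<open>v\<close> vanishes there and
      \<open>e\<close> does not.\<close>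
    have le: "lookup v i \<le> lookup e i" if "i \<in> \<Union>\<Delta>" for i
      using proj_ge[OF that, of v] M_pos by (simp add: e_def less_eq_div_iff_mult_less_eq mult.commute)
    then show "\<forall>i\<in>\<Union>\<Delta>. lookup v i \<le> lookup ?v i" by (auto simp: lookup_add intro: trans_le_add2)
    have "lookup v j < lookup ?v j"
      using v0 j(2) M_pos by (simp add: lookup_add e_def div_greater_zero_iff del: lookup_proj)
    then show "\<exists>i\<in>\<Union>\<Delta>. lookup v i < lookup ?v i" using j(1) facet_face[OF \<sigma>] by blast
  qed simp
  ultimately have "less_expo ?v v" by (simp add: less_expo_def)
  then show False using v vec unfolding nonstandard_def by blast
qed

lemma minimal_nonstandard_deg:
  assumes u: "u \<in> minimal_nonstandard a less_expo"
  shows "expo_deg u \<le> CARD('d)"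
proof (cases "keys (proj u) \<in> \<Delta>")
  case False
  then obtain \<rho> where \<rho>: "\<rho> \<subseteq> keys (proj u)" "\<rho> \<notin> \<Delta>" "card \<rho> \<le> CARD('d)" by (rule small_nonface)
  then have "\<forall>t\<in>\<rho>. \<exists>i. i \<in> keys u \<and> t \<in> keys (C i)" unfolding keys_proj by blast
  \<comment> \<open>For each element of the small nonface, \<open>s\<close> picks a variable of
    \<open>u\<close> whose projection involves it. The squarefree product of these variables divides
    \<open>u\<close> and already has a nonface projection, so minimality makes it all of
    \<open>u\<close>.\<close>
  then obtain s where s: "\<forall>t\<in>\<rho>. s t \<in> keys u \<and> t \<in> keys (C (s t))" by metis
  let ?w = "indic_expo (s ` \<rho>)"
  have "\<rho> \<subseteq> keys (proj ?w)" using s unfolding keys_proj by auto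
  then have "keys (proj ?w) \<notin> \<Delta>" using face_subset \<rho>(2) by blast
  then have "?w \<in> nonstd" by (rule nonface_proj_nonstandard)
  moreover have "u = ?w + (u - ?w)"
    using s by (intro expo_diff_add) (force simp: indic_expo_def in_keys_iff Suc_le_eq)
  ultimately have "?w = u" using u unfolding minimal_nonstandard_def by blast
  moreover have "expo_deg ?w = card (s ` \<rho>)" by (simp add: expo_deg_def indic_expo_def add: sum.If_cases)
  ultimately show ?thesis using card_image_le[of \<rho> s] \<rho>(3) by simp
next
  case True
  then obtain \<sigma> where \<sigma>: "\<sigma> \<in> facets \<Delta>" "keys (proj u) \<subseteq> \<sigma>" by (rule face_in_facet)
  have uN: "u \<in> nonstd" and umin: "\<And>w s. w \<in> nonstd \<Longrightarrow> u = w + s \<Longrightarrow> w = u"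
    using u unfolding minimal_nonstandard_def by blast+
  note lt = term_order_less_expo
  have graded_fibres: "\<forall>u v. expo_vec a u = expo_vec a v \<longrightarrow> expo_deg u = expo_deg v"
    using expo_deg_fibre by blast
  show ?thesis
  proof (rule ccontr)
    assume deg: "\<not> ?thesis"
    then have "u \<noteq> 0" by (auto simp: expo_deg_def)
    then obtain i where i: "lookup u i \<noteq> 0" by (metis lookup_zero poly_mapping_eqI)
    let ?e = "\<lambda>i. Poly_Mapping.single i 1 :: 'n expo"
    have split: "u = (u - ?e l) + ?e l" if "lookup u l \<noteq> 0" for l
      using that by (intro poly_mapping_eqI) (auto simp: lookup_add lookup_minus lookup_single when_def)
    have std: "u - ?e l \<notin> nonstd" if l: "lookup u l \<noteq> 0" for l
    proof
      assume "u - ?e l \<in> nonstd"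
      then have "u - ?e l = u" using umin split[OF l] by blast
      then have "lookup (u - ?e l) l = lookup u l" by simp
      then show False using l by (simp add: lookup_minus)
    qed
    \<comment> \<open>Dropping any one variable makes \<open>u\<close> standard, and the assumed
      degree leaves at least \<open>CARD('d)\<close>.\<close>
    let ?u = "u - ?e i"
    have "expo_deg (?e i) = 1" by (simp add: expo_deg_def lookup_single when_def)
    then have deg': "CARD('d) \<le> expo_deg ?u"
      using deg arg_cong[OF split[OF i], of expo_deg] by (simp add: expo_deg_add)
    have pu: "proj u = proj ?u + proj (?e i)" using split[OF i] proj_add by metis
    then have pu\<sigma>: "keys (proj ?u) \<subseteq> \<sigma>" using \<sigma>(2) by (auto simp: keys_expo_add)
    \<comment> \<open>Pigeonhole: the \<open>CARD('d)\<close> coordinates on \<sigma> add up to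
      \<open>M * expo_deg ?u\<close>, so they cannot all be below \<open>M\<close>.\<close>
    have "\<exists>j\<in>\<sigma>. M \<le> lookup (proj ?u) j"
    proof (rule ccontr)
      assume "\<not> ?thesis"
      then have "(\<Sum>j\<in>\<sigma>. lookup (proj ?u) j) < (\<Sum>j\<in>\<sigma>. M)"
        using card_facet[OF \<sigma>(1)] by (intro sum_strict_mono) (auto simp: not_le)
      also have "\<dots> \<le> M * expo_deg ?u" using deg' card_facet[OF \<sigma>(1)] by simp
      also have "\<dots> = (\<Sum>j\<in>\<sigma>. lookup (proj ?u) j)"
        unfolding expo_deg_proj[symmetric] unfolding expo_deg_def
        using pu\<sigma> by (intro sum.mono_neutral_right) (auto simp: in_keys_iff simp del: lookup_proj)
      finally show False by simp
    qed
    then obtain j where j: "j \<in> \<sigma>" "M \<le> lookup (proj ?u) j" by blast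
    let ?v = "fibre_min a less_expo u"
    note v = fibre_min[OF lt graded_fibres, where u = u]
    have v_less: "less_expo ?v u" using fibre_min_less[OF lt graded_fibres uN] .
    \<comment> \<open>If the projections differed, the face projection of \<open>u\<close> would
      make \<open>u\<close> smaller than its own normal form.\<close>
    have "\<not> less_expo u ?v" using v_less term_order_irrefl[OF lt] term_order_trans[OF lt] by metis
    then have pv: "proj ?v = proj u" using face_proj_less[OF True, of ?v] v(1) by metis
    have "M \<le> lookup (proj u) j" using j(2) unfolding pu by (simp add: lookup_add del: lookup_proj)
    then have vj: "lookup ?v j \<noteq> 0"
      using standard_vertex_divides[OF v(2) \<sigma>(1)] \<sigma>(2) j(1) unfolding pv by blast
    \<comment> \<open>The variable of \<open>j\<close> divides both the normal form and the standard
      monomial \<open>?u\<close>, hence \<open>u\<close>. Cancelling it leaves a smaller monomial in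
      the fibre of \<open>u - ?e j\<close>, which is standard.\<close>
    have "lookup ?u j \<noteq> 0" by (rule standard_vertex_divides[OF std[OF i] \<sigma>(1) pu\<sigma> j])
    then have uj: "lookup u j \<noteq> 0" by (metis lookup_add split[OF i] add_is_0)
    have vsplit: "?v = (?v - ?e j) + ?e j"
      using vj by (intro poly_mapping_eqI) (auto simp: lookup_add lookup_minus lookup_single when_def)
    have "less_expo (?v - ?e j) (u - ?e j)"
      using v_less term_order_add_cancel[OF lt] vsplit split[OF uj] by metis
    moreover have "expo_vec a (?v - ?e j) = expo_vec a (u - ?e j)"
      using v(1) vsplit split[OF uj] expo_vec_add by (metis add_right_cancel)
    ultimately show False using std[OF uj] unfolding nonstandard_def by blast
  qed
qed

end

section \<open>Passage from the given regular triangulation to the refined order\<close>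

theorem theorem4p1:
  fixes a :: "'n::finite \<Rightarrow> int ^ 'd::finite"
    and \<Delta> :: "'n set set"
  assumes "graded_config a"
    and "krull_dim_quotient (toric_ideal a :: ('n, 'k::field) mpoly set) = enat CARD('d)"
    and "delta_normal TYPE('k) a \<Delta>"
  shows "\<exists>lt. term_order lt \<and>
           is_initial_complex lt (toric_ideal a :: ('n, 'k) mpoly set) \<Delta> \<and>
           (\<exists>G. is_reduced_groebner_basis lt (toric_ideal a :: ('n, 'k) mpoly set) G \<and>
                (\<forall>g\<in>G. is_binomial g \<and> total_degree g \<le> CARD('d)))"
proof -
  obtain lt0 where lt0: "term_order lt0"
    and init: "is_initial_complex lt0 (toric_ideal a :: ('n, 'k) mpoly set) \<Delta>"
    and tri: "triangulation a \<Delta>"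
    using assms(3) unfolding delta_normal_def regular_triangulation_def by blast
  have complex: "simplicial_complex \<Delta>" using init by (simp add: is_initial_complex_def)
  \<comment> \<open>A nonstandard face monomial would lie in the initial ideal, hence in the
    Stanley-Reisner ideal, whose monomials all have nonface support.\<close>
  have face: "u \<notin> nonstandard a lt0" if "keys u \<in> \<Delta>" for u
  proof
    assume "u \<in> nonstandard a lt0"
    then have "mon u ^ 1 \<in> initial_ideal lt0 (toric_ideal a :: ('n, 'k) mpoly set)"
      unfolding initial_ideal_toric[OF lt0] by (simp add: mon_def)
    then have "mon u \<in> radical (initial_ideal lt0 (toric_ideal a :: ('n, 'k) mpoly set))"
      unfolding radical_def by blast
    then have "mon u \<in> (stanley_reisner_ideal \<Delta> :: ('n, 'k) mpoly set)"
      using init by (simp add: is_initial_complex_def)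
    then show False using that unfolding stanley_reisner_ideal_eq[OF complex] by (simp add: mon_def)
  qed
  have "normal_config a \<Delta> lt0"
  proof
    \<comment> \<open>By totality, a standard exponent is the least one of its fibre.\<close>
    show "lt0 u v" if "keys u \<in> \<Delta>" "expo_vec a v = expo_vec a u" "v \<noteq> u" for u v
      using face[OF that(1)] that(2,3) term_order_total[OF lt0] unfolding nonstandard_def by blast
  qed (use lt0 complex tri assms in \<open>auto simp: triangulation_def delta_normal_def\<close>)
  then interpret normal_config a \<Delta> lt0 .
  obtain M C where "M > 0" "\<And>i. keys (C i) \<in> \<Delta>" "\<And>i. expo_vec a (C i) = int M *s a i"
    using vertex_combinations by blast
  then interpret projected_config a \<Delta> lt0 M C by unfold_locales auto
  have "\<forall>u v. expo_vec a u = expo_vec a v \<longrightarrow> expo_deg u = expo_deg v"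
    using expo_deg_fibre by blast
  from reduced_groebner_basis_toric[OF term_order_less_expo this minimal_nonstandard_deg]
  show ?thesis using term_order_less_expo initial_complex_less_expo by blast
qed

end
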